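(* Consider a branching random walk with $\Phi(0)\in(0,\infty]$, $\Phi(1)=0$ and $\Phi$ finite in a neighborhood of $1$. Suppose $\Phi'(1)=0$. Define $$X=\sum_{|u|=1}\big[1+(V(u))_+\big]e^{-V(u)}.$$ If the random variable $X$ admits a finite exponential moment (i.e. $\mathbb{E}[e^{\delta X}]<\infty$ for some $\delta>0$), then there exist constants $C,c>0$ such that $$\mathbb{P}\big(D^{(x)}_n>y\big)\le C\,R(x)e^{-x}\,e^{-cy}$$ for all $x>0$, $y\ge1$ and $n\in\mathbb{N}\cup\{\infty\}$.
   Context: Branching random walk: let $\Xi$ be a point process on $\mathbb{R}$. The process starts with a single particle (the root $\rho$) at the origin at generation $0$. At each generation $n\ge1$, every particle of generation $n-1$ dies and is replaced, independently of the others, by a random (possibly infinite) number of offspring whose displacements from the parent are distributed as $\Xi$. The genealogical tree is $\mathcal{T}$. For $u\in\mathcal{T}$, $V(u)$ is its position, $|u|$ its generation, $[\rho,u]$ the set of ancestors of $u$ including $u$ itself, and $\underline{V}(u):=\min\{V(v):v\in[\rho,u]\}$. Write $a_+=\max(a,0)$. Log-Laplace transform: $\Phi(\theta):=\ln\mathbb{E}\big[\sum_{|u|=1}e^{-\theta V(u)}\big]\in(-\infty,\infty]$. Associated random walk: $(S_n)_{n\ge0}$ is, under $\mathbf{P}$, the random walk with $S_0=0$ and i.i.d. steps with law given by $\mathbf{E}[f(S_1)]=\mathbb{E}\big[\sum_{|u|=1}f(V(u))e^{-V(u)}\big]$ for all bounded continuous $f$. Renewal function: $R(u):=\mathbf{E}\big[\sum_{j=0}^{\tau^+-1}\mathbf{1}_{\{S_j\ge-u\}}\big]$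 for $u\ge0$, where $\tau^+:=\inf\{n\ge1:S_n\ge0\}$. Truncated derivative martingale: for $n\ge0$ and $x\ge0$, $$D_n^{(x)}:=\sum_{|u|=n}R(x+V(u))e^{-(x+V(u))}\mathbf{1}_{\{x+\underline{V}(u)\ge0\}}.$$ For each $x\ge0$ this is a non-negative martingale, and $D_\infty^{(x)}$ denotes its almost sure limit as $n\to\infty$. *)

theory Defs
  imports "HOL-Probability.Probability"
begin

section \<open>Logarithm and exponential on the extended half-line\<close>

definition ln_ennreal :: "ennreal \<Rightarrow> ereal" where
  "ln_ennreal m =
     (if m = 0 then - \<infinity> else if m = \<infinity> then \<infinity> else ereal (ln (enn2real m)))"

definition exp_ennreal :: "ennreal \<Rightarrow> ennreal" where
  "exp_ennreal a = (if a = \<infinity> then \<infinity> else ennreal (exp (enn2real a)))"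


section \<open>Branching random walk\<close>

text \<open>
  Particles carry Ulam--Harris labels: the label \<open>u @ [i]\<close> is the \<open>i\<close>-th potential child of \<open>u\<close>.
  The sequence \<open>\<xi> u \<omega>\<close> enumerates, with multiplicity, the points of the copy of the point process
  attached to \<open>u\<close>, i.e. the displacements of the children of \<open>u\<close>. The value \<open>\<infinity>\<close> marks a child that
  does not exist, so the number of children may be zero, finite or infinite. The common law of
  the sequences is arbitrary.
\<close>

type_synonym 'w displacements = "nat list \<Rightarrow> 'w \<Rightarrow> nat \<Rightarrow> ereal"

definition branching_random_walk :: "'w measure \<Rightarrow> 'w displacements \<Rightarrow> bool" where
  "branching_random_walk M \<xi> \<longleftrightarrow>
     prob_space M \<and>
     prob_space.indep_vars M (\<lambda>_. \<Pi>\<^sub>M i\<in>UNIV. borel) \<xi> UNIV \<and>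
     (\<forall>u. distr M (\<Pi>\<^sub>M i\<in>UNIV. borel) (\<xi> u) = distr M (\<Pi>\<^sub>M i\<in>UNIV. borel) (\<xi> [])) \<and>
     (\<forall>u i. \<forall>\<omega>\<in>space M. \<xi> u \<omega> i \<noteq> - \<infinity>)"

definition tree :: "'w displacements \<Rightarrow> 'w \<Rightarrow> nat list set" where
  "tree \<xi> \<omega> = {u. \<forall>k<length u. \<xi> (take k u) \<omega> (u ! k) \<noteq> \<infinity>}"

definition generation :: "'w displacements \<Rightarrow> nat \<Rightarrow> 'w \<Rightarrow> nat list set" where
  "generation \<xi> n \<omega> = {u \<in> tree \<xi> \<omega>. length u = n}"

definition position :: "'w displacements \<Rightarrow> nat list \<Rightarrow> 'w \<Rightarrow> real" where
  "position \<xi> u \<omega> = (\<Sum>k<length u. real_of_ereal (\<xi> (take k u) \<omega> (u ! k)))"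

definition ancestors :: "nat list \<Rightarrow> nat list set" where
  "ancestors u = {take k u | k. k \<le> length u}"

definition min_position :: "'w displacements \<Rightarrow> nat list \<Rightarrow> 'w \<Rightarrow> real" where
  "min_position \<xi> u \<omega> = Min ((\<lambda>v. position \<xi> v \<omega>) ` ancestors u)"

definition log_laplace :: "'w measure \<Rightarrow> 'w displacements \<Rightarrow> real \<Rightarrow> ereal" where
  "log_laplace M \<xi> \<theta> =
     ln_ennreal (\<integral>\<^sup>+\<omega>. (\<integral>\<^sup>+u. ennreal (exp (- \<theta> * position \<xi> u \<omega>))
       \<partial>count_space (generation \<xi> 1 \<omega>)) \<partial>M)"

definition first_generation_sum :: "'w displacements \<Rightarrow> 'w \<Rightarrow> ennreal" where
  "first_generation_sum \<xi> \<omega> =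
     (\<integral>\<^sup>+u. ennreal ((1 + max (position \<xi> u \<omega>) 0) * exp (- position \<xi> u \<omega>))
       \<partial>count_space (generation \<xi> 1 \<omega>))"


section \<open>Associated random walk and its renewal function\<close>

definition associated_walk ::
    "'w measure \<Rightarrow> 'w displacements \<Rightarrow> 'b measure \<Rightarrow> (nat \<Rightarrow> 'b \<Rightarrow> real) \<Rightarrow> bool" where
  "associated_walk M \<xi> P S \<longleftrightarrow>
     prob_space P \<and>
     (\<forall>\<omega>\<in>space P. S 0 \<omega> = 0) \<and>
     prob_space.indep_vars P (\<lambda>_. borel) (\<lambda>n \<omega>. S (Suc n) \<omega> - S n \<omega>) UNIV \<and>
     (\<forall>n. distr P borel (\<lambda>\<omega>. S (Suc n) \<omega> - S n \<omega>) = distr P borel (S 1)) \<and>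
     (\<forall>f :: real \<Rightarrow> real. continuous_on UNIV f \<and> bounded (range f) \<longrightarrow>
        (\<integral>\<omega>. f (S 1 \<omega>) \<partial>P) =
        (\<integral>\<omega>. (\<integral>u. f (position \<xi> u \<omega>) * exp (- position \<xi> u \<omega>)
           \<partial>count_space (generation \<xi> 1 \<omega>)) \<partial>M))"

definition first_return_nonneg :: "(nat \<Rightarrow> 'b \<Rightarrow> real) \<Rightarrow> 'b \<Rightarrow> enat" where
  "first_return_nonneg S \<omega> = Inf {enat n | n. n \<ge> 1 \<and> S n \<omega> \<ge> 0}"

definition renewal :: "'b measure \<Rightarrow> (nat \<Rightarrow> 'b \<Rightarrow> real) \<Rightarrow> real \<Rightarrow> ennreal" where
  "renewal P S x =
     (\<integral>\<^sup>+\<omega>. (\<integral>\<^sup>+j. indicator {j. S j \<omega> \<ge> - x} j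
       \<partial>count_space {j. enat j < first_return_nonneg S \<omega>}) \<partial>P)"


section \<open>Truncated derivative martingale\<close>

definition trunc_deriv_mart ::
    "'w displacements \<Rightarrow> 'b measure \<Rightarrow> (nat \<Rightarrow> 'b \<Rightarrow> real) \<Rightarrow> real \<Rightarrow> nat \<Rightarrow> 'w \<Rightarrow> ennreal" where
  "trunc_deriv_mart \<xi> P S x n \<omega> =
     (\<integral>\<^sup>+u. renewal P S (x + position \<xi> u \<omega>) * ennreal (exp (- (x + position \<xi> u \<omega>)))
           * indicator {u. x + min_position \<xi> u \<omega> \<ge> 0} u
       \<partial>count_space (generation \<xi> n \<omega>))"

text \<open>
  The value at \<open>\<infinity>\<close> is the pointwise limit; it is unspecified on the null set of those \<open>\<omega>\<close> for
  which the martingale does not converge.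
\<close>

definition trunc_deriv_mart_ext ::
    "'w displacements \<Rightarrow> 'b measure \<Rightarrow> (nat \<Rightarrow> 'b \<Rightarrow> real) \<Rightarrow> real \<Rightarrow> enat \<Rightarrow> 'w \<Rightarrow> ennreal" where
  "trunc_deriv_mart_ext \<xi> P S x n \<omega> =
     (case n of enat k \<Rightarrow> trunc_deriv_mart \<xi> P S x k \<omega>
              | \<infinity> \<Rightarrow> lim (\<lambda>k. trunc_deriv_mart \<xi> P S x k \<omega>))"

end

(*
  Let R be the renewal function. Splitting off the last instead of the first step shows that R is
  superharmonic for the associated walk killed below 0, and a Wiener-Hopf type identity bounds R
  linearly. For small c the function g(x) = c (R(x) + b (1 - a exp(-l x))) exp(-x) satisfies
  E exp (sum over |u| = 1 with x + V(u) >= 0 of g(x + V(u))) <= exp (g(x)):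
  the bounded correction produces a drift of order exp(-(1 + l) x), which dominates the second-order
  term of the exponential, of order (1 + x)^2 exp(-2 x) by the exponential moment of X. As the
  offspring of different particles are independent, exp (sum over |u| = n of g(x + V(u))) is a
  supermartingale, so E exp(c D_n) <= exp(g(x)), where g(x) is of order R(x) exp(-x), and Markov's
  inequality for exp(c D_n) - 1 gives the tail. For n = infinity, the nonnegative supermartingale
  D_n converges almost surely by Dubins' upcrossing argument.
*)

theory Submission
  imports Defs
begin

section \<open>Independent copies\<close>

text \<open>The obstacle: the one-step inequality for the renewal function has no slack to spare,
  while exp(t) exceeds 1 + t by a term of order t^2, so the exponential of a multiple of the
  martingale need not be a supermartingale. The correction has to gain at least a multiple of (1 +
  x)^2 exp(-2 x) at every x >= 0 and yet stay bounded, so that g remains comparable with R(x)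
  exp(-x). Since (1 + x)^2 <= 16 exp(x / 2), a gain of order exp(-(1 + l) x) with l <= 1/2 is
  enough. Taking b proportional to c gives gain and loss the same order c^2, and the factor of
  proportionality decides between them. Infinite families are handled by summing only over labels
  with entries below m: all sums and products are then finite, the bounds are uniform in m, and
  monotone convergence removes m. Independence enters by resampling one coordinate of a product
  space, without conditional expectations.\<close>

lemma nn_integral_PiM_resample:
  fixes N :: "'a measure" and f :: "('i \<Rightarrow> 'a) \<Rightarrow> ennreal"
  assumes N: "prob_space N" and f: "f \<in> borel_measurable (\<Pi>\<^sub>M i\<in>UNIV. N)"
  shows "(\<integral>\<^sup>+w. f w \<partial>(\<Pi>\<^sub>M i\<in>UNIV. N)) =
    (\<integral>\<^sup>+w. (\<integral>\<^sup>+y. f (w(u := y)) \<partial>N) \<partial>(\<Pi>\<^sub>M i\<in>UNIV. N))"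
proof -
  let ?P = "\<Pi>\<^sub>M i\<in>(UNIV :: 'i set). N"
  interpret N: prob_space N by fact
  interpret P: prob_space ?P by (intro prob_space_PiM N)
  interpret pair_sigma_finite N ?P ..
  have "(\<lambda>(x, X). X(u := x)) \<in> N \<Otimes>\<^sub>M (\<Pi>\<^sub>M i\<in>UNIV. N) \<rightarrow>\<^sub>M (\<Pi>\<^sub>M i\<in>insert u UNIV. N)"
    unfolding split_def by (rule measurable_fun_upd) auto
  then have meas [measurable]: "(\<lambda>(x, X). X(u := x)) \<in> N \<Otimes>\<^sub>M ?P \<rightarrow>\<^sub>M ?P"
    by simp
  have "?P = distr (N \<Otimes>\<^sub>M ?P) ?P (\<lambda>(x, X). X(u := x))"
    using distr_pair_PiM_eq_PiM[of UNIV "\<lambda>_. N" u] N by simp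
  then have "(\<integral>\<^sup>+w. f w \<partial>?P) = (\<integral>\<^sup>+w. f w \<partial>distr (N \<Otimes>\<^sub>M ?P) ?P (\<lambda>(x, X). X(u := x)))"
    by simp
  also have "\<dots> = (\<integral>\<^sup>+z. f (case z of (x, X) \<Rightarrow> X(u := x)) \<partial>(N \<Otimes>\<^sub>M ?P))"
    by (rule nn_integral_distr) (use f in auto)
  also have "\<dots> = (\<integral>\<^sup>+w. (\<integral>\<^sup>+y. f (w(u := y)) \<partial>N) \<partial>?P)"
  proof (subst nn_integral_snd[symmetric])
    show "(\<lambda>z. f (case z of (x, X) \<Rightarrow> X(u := x))) \<in> borel_measurable (N \<Otimes>\<^sub>M ?P)"
      using f by measurable
  qed simp
  finally show ?thesis .
qed

lemma measurable_fun_upd_UNIV [measurable (raw)]: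
  assumes "f \<in> A \<rightarrow>\<^sub>M (\<Pi>\<^sub>M i\<in>UNIV. N)" "g \<in> A \<rightarrow>\<^sub>M N"
  shows "(\<lambda>x. (f x)(u := g x)) \<in> A \<rightarrow>\<^sub>M (\<Pi>\<^sub>M i\<in>UNIV. N)"
  using measurable_fun_upd[of UNIV UNIV u f A "\<lambda>_. N" g] assms by simp

text \<open>\<open>Q u\<close> may read coordinate u but no other coordinate from \<open>U\<close>,
  so the coordinates can be integrated out one after the other. \<open>H\<close> carries the
  induction: once \<open>Q u\<close> has been replaced by \<open>G u\<close>, which reads no
  coordinate from \<open>U\<close>, that factor is moved into \<open>H\<close>.\<close>

lemma nn_integral_PiM_prod_le:
  fixes N :: "'a measure" and H :: "('i \<Rightarrow> 'a) \<Rightarrow> ennreal"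
  assumes N: "prob_space N" and "finite U"
    and H [measurable]: "H \<in> borel_measurable (\<Pi>\<^sub>M i\<in>UNIV. N)"
    and Q [measurable]: "\<And>u. Q u \<in> borel_measurable (\<Pi>\<^sub>M i\<in>UNIV. N)"
    and G [measurable]: "\<And>u. G u \<in> borel_measurable (\<Pi>\<^sub>M i\<in>UNIV. N)"
    and H_upd: "\<And>w u y. u \<in> U \<Longrightarrow> H (w(u := y)) = H w"
    and Q_upd: "\<And>w u v y. u \<in> U \<Longrightarrow> v \<in> U \<Longrightarrow> u \<noteq> v \<Longrightarrow> Q v (w(u := y)) = Q v w"
    and G_upd: "\<And>w u v y. u \<in> U \<Longrightarrow> v \<in> U \<Longrightarrow> G v (w(u := y)) = G v w"
    and le: "\<And>w u. u \<in> U \<Longrightarrow> w \<in> space (\<Pi>\<^sub>M i\<in>UNIV. N) \<Longrightarrow>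
      (\<integral>\<^sup>+y. Q u (w(u := y)) \<partial>N) \<le> G u w"
  shows "(\<integral>\<^sup>+w. H w * (\<Prod>u\<in>U. Q u w) \<partial>(\<Pi>\<^sub>M i\<in>UNIV. N)) \<le>
    (\<integral>\<^sup>+w. H w * (\<Prod>u\<in>U. G u w) \<partial>(\<Pi>\<^sub>M i\<in>UNIV. N))"
  using \<open>finite U\<close> H H_upd Q_upd G_upd le
proof (induction U arbitrary: H rule: finite_induct)
  case empty
  then show ?case by simp
next
  case (insert u U)
  let ?P = "\<Pi>\<^sub>M i\<in>(UNIV :: 'i set). N"
  note [measurable] = insert.prems(1)
  have [measurable]: "(\<lambda>y. Q u (w(u := y))) \<in> borel_measurable N" if "w \<in> space ?P" for w
    using that by measurable
  have upd: "(\<Prod>v\<in>U. Q v (w(u := y))) = (\<Prod>v\<in>U. Q v w)" for w y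
    by (intro prod.cong refl insert.prems(3)) (use insert.hyps in auto)
  have "(\<integral>\<^sup>+w. H w * (\<Prod>v\<in>insert u U. Q v w) \<partial>?P) =
      (\<integral>\<^sup>+w. (H w * (\<Prod>v\<in>U. Q v w)) * Q u w \<partial>?P)"
    using insert.hyps by (simp add: mult_ac)
  also have "\<dots> = (\<integral>\<^sup>+w. (\<integral>\<^sup>+y. (H w * (\<Prod>v\<in>U. Q v w)) * Q u (w(u := y)) \<partial>N) \<partial>?P)"
    by (subst nn_integral_PiM_resample[OF N, where u = u])
      (simp_all add: upd insert.prems(2))
  also have "\<dots> = (\<integral>\<^sup>+w. (H w * (\<Prod>v\<in>U. Q v w)) * (\<integral>\<^sup>+y. Q u (w(u := y)) \<partial>N) \<partial>?P)"
    by (intro nn_integral_cong nn_integral_cmult) simp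
  also have "\<dots> \<le> (\<integral>\<^sup>+w. (H w * (\<Prod>v\<in>U. Q v w)) * G u w \<partial>?P)"
    by (intro nn_integral_mono mult_left_mono insert.prems) auto
  also have "\<dots> = (\<integral>\<^sup>+w. (H w * G u w) * (\<Prod>v\<in>U. Q v w) \<partial>?P)"
    by (simp add: mult_ac)
  also have "\<dots> \<le> (\<integral>\<^sup>+w. (H w * G u w) * (\<Prod>v\<in>U. G v w) \<partial>?P)"
    using insert.prems by (intro insert.IH) auto
  also have "\<dots> = (\<integral>\<^sup>+w. H w * (\<Prod>v\<in>insert u U. G v w) \<partial>?P)"
    using insert.hyps by (simp add: mult_ac)
  finally show ?case .
qed

text \<open>Carries the steps of the walk and the displacement families over to product spaces,
  where the estimates are made.\<close>

lemma (in prob_space) distr_iid_eq_PiM: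
  assumes indep: "indep_vars (\<lambda>_. N) X UNIV"
    and law: "\<And>i. distr M N (X i) = L"
  shows "distr M (\<Pi>\<^sub>M i\<in>UNIV. N) (\<lambda>w i. X i w) = (\<Pi>\<^sub>M i\<in>UNIV. L)"
proof -
  have rv: "X i \<in> M \<rightarrow>\<^sub>M N" for i
    using indep by (auto simp: indep_vars_def)
  show ?thesis
    using iffD1[OF indep_vars_iff_distr_eq_PiM[OF _ rv] indep] by (simp add: restrict_def law)
qed

section \<open>Lyapunov functions for the killed walk\<close>

text \<open>The quadratic term is restricted to the positive part because exp(t) < 1 + t + t^2 / 2
  for t < 0.\<close>

lemma one_plus_le_exp: "1 + t + (max t 0)\<^sup>2 / 2 \<le> exp t" for t :: real
proof (cases "t \<ge> 0")
  case True
  then show ?thesis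
    using exp_lower_Taylor_quadratic[of t] by (simp add: max_def)
next
  case False
  then show ?thesis
    using exp_ge_add_one_self[of t] by (simp add: max_def)
qed

lemma (in prob_space) exp_moment_quadratic_lower:
  fixes Z :: "'a \<Rightarrow> real"
  assumes Z: "integrable M Z" "expectation Z = 0" and nondeg: "\<not> (AE z in M. Z z = 0)"
  shows "\<exists>k>0. \<forall>h>0. integrable M (\<lambda>z. exp (h * Z z)) \<longrightarrow>
    1 + k * h\<^sup>2 \<le> expectation (\<lambda>z. exp (h * Z z))"
proof -
  \<comment> \<open>The cut-off at 1 makes \<open>Y\<close> integrable whatever the tail of
    \<open>Z\<close>. It is applied before scaling by h, so the constant obtained does not depend on
    h.\<close>
  define Y where "Y z = (min (max (Z z) 0) 1)\<^sup>2" for z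
  have [measurable]: "Z \<in> borel_measurable M"
    using Z by auto
  have Y_meas [measurable]: "Y \<in> borel_measurable M"
    unfolding Y_def by measurable
  have Y_int: "integrable M Y"
    by (rule integrable_const_bound[of _ 1]) (auto simp: Y_def power_le_one)
  \<comment> \<open>If the positive part of \<open>Z\<close> vanished almost surely, then - Z would
    be nonnegative with mean zero, hence zero.\<close>
  have "expectation Y \<noteq> 0"
  proof
    assume "expectation Y = 0"
    then have "AE z in M. Y z = 0"
      using integral_nonneg_eq_0_iff_AE[OF Y_int] by (simp add: Y_def)
    then have le: "AE z in M. 0 \<le> - Z z"
      by eventually_elim (auto simp: Y_def min_def max_def split: if_splits)
    have "AE z in M. - Z z = 0"
      using integral_nonneg_eq_0_iff_AE[of M "\<lambda>z. - Z z"] Z le by simp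
    then show False
      using nondeg by simp
  qed
  then have Y_pos: "expectation Y > 0"
    using Bochner_Integration.integral_nonneg[of M Y] by (simp add: Y_def order_less_le)
  show ?thesis
  proof (intro exI[of _ "expectation Y / 2"] conjI allI impI)
    fix h :: real assume h: "h > 0" and int: "integrable M (\<lambda>z. exp (h * Z z))"
    have "1 + expectation Y / 2 * h\<^sup>2 = expectation (\<lambda>z. 1 + h * Z z + h\<^sup>2 / 2 * Y z)"
      using Z Y_int by (simp add: prob_space)
    also have "\<dots> \<le> expectation (\<lambda>z. exp (h * Z z))"
    proof (rule integral_mono)
      fix z
      have "Y z \<le> (max (Z z) 0)\<^sup>2"
        unfolding Y_def by (intro power_mono) auto
      then have "h\<^sup>2 * Y z \<le> h\<^sup>2 * (max (Z z) 0)\<^sup>2"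
        by (intro mult_left_mono) auto
      also have "\<dots> = (max (h * Z z) 0)\<^sup>2"
        using h by (simp add: max_def power_mult_distrib mult_le_0_iff)
      finally show "1 + h * Z z + h\<^sup>2 / 2 * Y z \<le> exp (h * Z z)"
        using one_plus_le_exp[of "h * Z z"] by simp
    qed (use Z Y_int int in auto)
    finally show "1 + expectation Y / 2 * h\<^sup>2 \<le> expectation (\<lambda>z. exp (h * Z z))" .
  qed (use Y_pos in auto)
qed

text \<open>
  With \<open>t = a e\<^bsup>-l(x+Z)\<^esup>\<close> the integrand is at most \<open>1 - t + t\<^sup>2\<close>, whether or not the walk is killed;
  the term \<open>t\<^sup>2\<close> is negligible for small \<open>a\<close>.
\<close>

lemma (in prob_space) exp_lyapunov:
  fixes Z :: "'a \<Rightarrow> real"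
  assumes [measurable]: "Z \<in> borel_measurable M"
    and int1: "integrable M (\<lambda>z. exp (- (l * Z z)))"
    and int2: "integrable M (\<lambda>z. exp (- (2 * l * Z z)))"
    and l: "0 < l"
    and gt: "expectation (\<lambda>z. exp (- (l * Z z))) > 1"
  shows "\<exists>a k. 0 < a \<and> a \<le> 1 / 2 \<and> 0 < k \<and> (\<forall>x\<ge>0.
    (\<integral>\<^sup>+z. ennreal (1 - a * exp (- (l * (x + Z z)))) * indicator {0..} (x + Z z) \<partial>M)
      + ennreal (k * exp (- (l * x))) \<le> ennreal (1 - a * exp (- (l * x))))"
proof -
  define m where "m = expectation (\<lambda>z. exp (- (l * Z z))) - 1"
  define m2 where "m2 = expectation (\<lambda>z. exp (- (2 * l * Z z)))"
  have m: "m > 0" and m2: "m2 \<ge> 0"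
    using gt by (auto simp: m_def m2_def)
  \<comment> \<open>With this \<open>a\<close> the quadratic term is at most half of the linear gain
    a e m; the other half provides k = a m / 2. The bound 1/2 keeps the function positive on x >=
    0.\<close>
  define a where "a = min (1 / 2) (m / (2 * (m2 + 1)))"
  have "0 < a"
    using m m2 by (simp add: a_def)
  moreover have "a \<le> 1 / 2"
    unfolding a_def by (rule min.cobounded1)
  ultimately have a: "0 < a" "a \<le> 1 / 2" .
  have "a * m2 \<le> m / (2 * (m2 + 1)) * (m2 + 1)"
    using m m2 a by (intro mult_mono) (auto simp: a_def)
  also have "\<dots> = m / 2"
    using m2 by (simp add: divide_simps)
  finally have am2: "a * m2 \<le> m / 2" .
  show ?thesis
  proof (rule exI[of _ a], rule exI[of _ "a * m / 2"], intro conjI allI impI)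
    fix x :: real assume x: "x \<ge> 0"
    define e where "e = exp (- (l * x))"
    have e: "0 < e" "e \<le> 1"
      using l x by (auto simp: e_def)
    define g where "g z = 1 - a * e * exp (- (l * Z z)) + a\<^sup>2 * e\<^sup>2 * exp (- (2 * l * Z z))" for z
    have g_int: "integrable M g"
      unfolding g_def using int1 int2 by simp
    have sq: "g z = 1 - a * exp (- (l * (x + Z z))) + (a * exp (- (l * (x + Z z))))\<^sup>2" for z
      by (simp add: g_def e_def power_mult_distrib power2_eq_square distrib_left exp_add[symmetric]
          mult_exp_exp algebra_simps)
    have g_ge: "0 \<le> g z" "1 - a * exp (- (l * (x + Z z))) \<le> g z" for z
    proof -
      have "0 \<le> 1 - t + t\<^sup>2" for t :: real
        using zero_le_power2[of "t - 1 / 2"] by (simp add: power2_eq_square algebra_simps)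
      then show "0 \<le> g z"
        unfolding sq .
    qed (simp add: sq)
    have E_g: "expectation g = 1 - a * e * (1 + m) + a\<^sup>2 * e\<^sup>2 * m2"
      unfolding g_def using int1 int2 by (simp add: m_def m2_def prob_space)
    have "a\<^sup>2 * e\<^sup>2 * m2 = a * e * (e * (a * m2))"
      by (simp add: power2_eq_square)
    also have "\<dots> \<le> a * e * (1 * (m / 2))"
      using e a am2 m2 by (intro mult_left_mono mult_mono) auto
    finally have E_le: "expectation g + a * m / 2 * e \<le> 1 - a * e"
      unfolding E_g by (simp add: algebra_simps)
    have "(\<integral>\<^sup>+z. ennreal (1 - a * exp (- (l * (x + Z z)))) * indicator {0..} (x + Z z) \<partial>M)
        \<le> (\<integral>\<^sup>+z. ennreal (g z) \<partial>M)"
      by (intro nn_integral_mono) (auto split: split_indicator intro!: ennreal_leI g_ge)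
    also have "\<dots> = ennreal (expectation g)"
      by (rule nn_integral_eq_integral) (use g_int g_ge in auto)
    finally have "(\<integral>\<^sup>+z. ennreal (1 - a * exp (- (l * (x + Z z)))) * indicator {0..} (x + Z z) \<partial>M)
        + ennreal (a * m / 2 * e) \<le> ennreal (expectation g) + ennreal (a * m / 2 * e)"
      by (rule add_right_mono)
    also have "\<dots> = ennreal (expectation g + a * m / 2 * e)"
      by (rule ennreal_plus[symmetric])
        (use a m e g_ge in \<open>auto intro!: Bochner_Integration.integral_nonneg\<close>)
    also have "\<dots> \<le> ennreal (1 - a * e)"
      using E_le by (rule ennreal_leI)
    finally show "(\<integral>\<^sup>+z. ennreal (1 - a * exp (- (l * (x + Z z)))) * indicator {0..} (x + Z z) \<partial>M)
        + ennreal (a * m / 2 * exp (- (l * x))) \<le> ennreal (1 - a * exp (- (l * x)))"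
      by (simp add: e_def)
  qed (use a m in auto)
qed

text \<open>Moments up to 2 l serve the squared exponential in \<open>exp_lyapunov\<close>. Mean
  zero is added only in \<open>step_law\<close>, since \<open>mean_zero\<close> derives it inside
  the present locale.\<close>

locale exp_law = prob_space L for L :: "real measure" +
  fixes l :: real
  assumes sets_L [measurable_cong]: "sets L = sets borel"
    and l: "0 < l" "l \<le> 1 / 2"
    and exp_int: "integrable L (\<lambda>z. exp (2 * l * z))" "integrable L (\<lambda>z. exp (- (2 * l * z)))"
begin

lemma exp_integrable:
  assumes "\<bar>s\<bar> \<le> 2 * l"
  shows "integrable L (\<lambda>z. exp (s * z))"
proof (rule Bochner_Integration.integrable_bound)
  show "integrable L (\<lambda>z. exp (2 * l * z) + exp (- (2 * l * z)))"
    using exp_int by simp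
  show "AE z in L. norm (exp (s * z)) \<le> norm (exp (2 * l * z) + exp (- (2 * l * z)))"
  proof (rule AE_I2)
    fix z
    have "s * z \<le> \<bar>s\<bar> * \<bar>z\<bar>"
      by (metis abs_ge_self abs_mult)
    also have "\<dots> \<le> 2 * l * \<bar>z\<bar>"
      using assms by (intro mult_right_mono) auto
    finally have "exp (s * z) \<le> exp (2 * l * \<bar>z\<bar>)"
      by simp
    also have "\<dots> \<le> exp (2 * l * z) + exp (- (2 * l * z))"
      by (cases "z \<ge> 0") auto
    finally show "norm (exp (s * z)) \<le> norm (exp (2 * l * z) + exp (- (2 * l * z)))"
      by simp
  qed
qed measurable

lemma integrable_id: "integrable L (\<lambda>z. z)"
proof (rule Bochner_Integration.integrable_bound)
  show "integrable L (\<lambda>z. (exp (2 * l * z) + exp (- (2 * l * z))) / (2 * l))"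
    using exp_int by simp
  show "AE z in L. norm z \<le> norm ((exp (2 * l * z) + exp (- (2 * l * z))) / (2 * l))"
  proof (rule AE_I2)
    fix z
    have "2 * l * \<bar>z\<bar> \<le> exp (2 * l * \<bar>z\<bar>)"
      using exp_ge_add_one_self[of "2 * l * \<bar>z\<bar>"] by linarith
    also have "\<dots> \<le> exp (2 * l * z) + exp (- (2 * l * z))"
      by (cases "z \<ge> 0") auto
    finally have "\<bar>z\<bar> \<le> (exp (2 * l * z) + exp (- (2 * l * z))) / (2 * l)"
      using l by (simp add: field_simps)
    then show "norm z \<le> norm ((exp (2 * l * z) + exp (- (2 * l * z))) / (2 * l))"
      using l by simp
  qed
qed measurable

end

locale step_law = exp_law L l for L :: "real measure" and l :: real +
  assumes mean: "(\<integral>z. z \<partial>L) = 0"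
    and nondeg: "\<not> (AE z in L. z = 0)"
begin

lemma exp_moment_ge:
  "\<exists>k>0. \<forall>h>0. integrable L (\<lambda>z. exp (h * z)) \<longrightarrow> 1 + k * h\<^sup>2 \<le> expectation (\<lambda>z. exp (h * z))"
  using exp_moment_quadratic_lower[of "\<lambda>z. z"] integrable_id mean nondeg by simp

lemma exp_moment_gt_1:
  "expectation (\<lambda>z. exp (l * z)) > 1" "expectation (\<lambda>z. exp (- (l * z))) > 1"
proof -
  obtain k1 where "k1 > 0" "\<forall>h>0. integrable L (\<lambda>z. exp (h * z)) \<longrightarrow> 1 + k1 * h\<^sup>2 \<le> expectation (\<lambda>z. exp (h * z))"
    using exp_moment_ge by blast
  then have "1 + k1 * l\<^sup>2 \<le> expectation (\<lambda>z. exp (l * z))" "k1 * l\<^sup>2 > 0"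
    using l exp_integrable[of l] by auto
  then show "expectation (\<lambda>z. exp (l * z)) > 1"
    by simp
  obtain k2 where "k2 > 0" "\<forall>h>0. integrable L (\<lambda>z. exp (h * - z)) \<longrightarrow> 1 + k2 * h\<^sup>2 \<le> expectation (\<lambda>z. exp (h * - z))"
    using exp_moment_quadratic_lower[of "\<lambda>z. - z"] integrable_id mean nondeg by auto
  then have "1 + k2 * l\<^sup>2 \<le> expectation (\<lambda>z. exp (- (l * z)))" "k2 * l\<^sup>2 > 0"
    using l exp_integrable[of "- l"] by auto
  then show "expectation (\<lambda>z. exp (- (l * z))) > 1"
    by simp
qed

lemma lyapunov_right:
  "\<exists>a k. 0 < a \<and> a \<le> 1 / 2 \<and> 0 < k \<and> (\<forall>x\<ge>0.
    (\<integral>\<^sup>+z. ennreal (1 - a * exp (- (l * (x + z)))) * indicator {0..} (x + z) \<partial>L)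
      + ennreal (k * exp (- (l * x))) \<le> ennreal (1 - a * exp (- (l * x))))"
  using exp_lyapunov[of "\<lambda>z. z" l] exp_moment_gt_1 l exp_int exp_integrable[of "- l"] by simp

text \<open>The reflection of \<open>lyapunov_right\<close>. It bounds the time that the walk spends
  near 0 before its return to [0, infinity), whereas \<open>lyapunov_right\<close> supplies the
  correction to the renewal function.\<close>

lemma lyapunov_left:
  "\<exists>a k. 0 < a \<and> a \<le> 1 / 2 \<and> 0 < k \<and> (\<forall>s\<le>0.
    (\<integral>\<^sup>+z. ennreal (1 - a * exp (l * (s + z))) * indicator {..0} (s + z) \<partial>L)
      + ennreal (k * exp (l * s)) \<le> ennreal (1 - a * exp (l * s)))"
proof -
  obtain a k where *: "0 < a" "a \<le> 1 / 2" "0 < k" "\<And>x. x \<ge> 0 \<Longrightarrow>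
      (\<integral>\<^sup>+z. ennreal (1 - a * exp (- (l * (x + - z)))) * indicator {0..} (x + - z) \<partial>L)
      + ennreal (k * exp (- (l * x))) \<le> ennreal (1 - a * exp (- (l * x)))"
    using exp_lyapunov[of "\<lambda>z. - z" l] exp_moment_gt_1 l exp_int exp_integrable[of "l"] by auto
  have ind: "indicator {0..} (- s - z) = (indicator {..0} (s + z) :: ennreal)" for s z :: real
    by (auto split: split_indicator)
  have "(\<integral>\<^sup>+z. ennreal (1 - a * exp (l * (s + z))) * indicator {..0} (s + z) \<partial>L)
      + ennreal (k * exp (l * s)) \<le> ennreal (1 - a * exp (l * s))" if "s \<le> 0" for s
    using *(4)[of "- s"] that by (simp add: ind algebra_simps)
  then show ?thesis
    using *(1-3) by blast
qed

end

section \<open>The renewal function\<close>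

definition walk :: "nat \<Rightarrow> (nat \<Rightarrow> real) \<Rightarrow> real" where
  "walk j w = (\<Sum>i<j. w i)"

text \<open>The event that tau^+ exceeds j. Time 0 is left out, so the start at 0 does not count as
  a return.\<close>

definition stays_neg :: "nat \<Rightarrow> (nat \<Rightarrow> real) \<Rightarrow> bool" where
  "stays_neg j w \<longleftrightarrow> (\<forall>k\<in>{1..j}. walk k w < 0)"

lemma walk_0 [simp]: "walk 0 w = 0"
  and walk_Suc: "walk (Suc j) w = walk j w + w j"
  by (simp_all add: walk_def)

lemma walk_upd: "walk j (w(i := y)) = walk j w" if "j \<le> i"
  using that by (auto simp: walk_def intro!: sum.cong)

lemma stays_neg_0 [simp]: "stays_neg 0 w"
  and stays_neg_Suc: "stays_neg (Suc j) w \<longleftrightarrow> stays_neg j w \<and> walk (Suc j) w < 0"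
  by (auto simp: stays_neg_def atLeastAtMostSuc_conv)

lemma stays_neg_upd: "stays_neg j (w(i := y)) = stays_neg j w" if "j \<le> i"
  using that by (auto simp: stays_neg_def walk_upd)

lemma walk_nonpos: "stays_neg j w \<Longrightarrow> walk j w \<le> 0"
  by (cases j) (auto simp: stays_neg_Suc)

lemma measurable_walk [measurable]:
  "walk j \<in> borel_measurable (\<Pi>\<^sub>M i\<in>UNIV. borel)"
  unfolding walk_def by measurable

lemma measurable_stays_neg [measurable]:
  "Measurable.pred (\<Pi>\<^sub>M i\<in>UNIV. borel) (stays_neg j)"
  unfolding stays_neg_def by measurable

context step_law
begin

abbreviation paths :: "(nat \<Rightarrow> real) measure" where
  "paths \<equiv> \<Pi>\<^sub>M i\<in>UNIV. L"

lemma sets_paths [measurable_cong]: "sets paths = sets (\<Pi>\<^sub>M i\<in>UNIV. borel)"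
  by (intro sets_PiM_cong refl sets_L)

lemma prob_space_paths: "prob_space paths"
  by (intro prob_space_PiM prob_space_axioms)

definition green :: "nat \<Rightarrow> (real \<Rightarrow> ennreal) \<Rightarrow> ennreal" where
  "green j f = (\<integral>\<^sup>+w. f (walk j w) * indicator {w. stays_neg j w} w \<partial>paths)"

text \<open>The index is shifted: f is integrated against the law of the ladder height on the event
  that tau^+ equals \<open>Suc j\<close>.\<close>

definition exit :: "nat \<Rightarrow> (real \<Rightarrow> ennreal) \<Rightarrow> ennreal" where
  "exit j f = (\<integral>\<^sup>+w. f (walk (Suc j) w) * indicator {w. stays_neg j w \<and> walk (Suc j) w \<ge> 0} w \<partial>paths)"

lemma green_0: "f \<in> borel_measurable borel \<Longrightarrow> green 0 f = f 0"
  using prob_space.emeasure_space_1[OF prob_space_paths] by (simp add: green_def)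

lemma green_mono: "(\<And>s. s \<le> 0 \<Longrightarrow> f s \<le> g s) \<Longrightarrow> green j f \<le> green j g"
  unfolding green_def
  by (intro nn_integral_mono) (auto split: split_indicator simp: walk_nonpos)

lemma exit_mono: "(\<And>s. s \<ge> 0 \<Longrightarrow> f s \<le> g s) \<Longrightarrow> exit j f \<le> exit j g"
  unfolding exit_def by (intro nn_integral_mono) (auto split: split_indicator)

lemma green_add:
  assumes [measurable]: "f \<in> borel_measurable borel" "g \<in> borel_measurable borel"
  shows "green j (\<lambda>s. f s + g s) = green j f + green j g"
  unfolding green_def by (simp add: distrib_right nn_integral_add)

lemma exit_add:
  assumes [measurable]: "f \<in> borel_measurable borel" "g \<in> borel_measurable borel"
  shows "exit j (\<lambda>s. f s + g s) = exit j f + exit j g"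
  unfolding exit_def by (simp add: distrib_right nn_integral_add)

lemma green_cmult:
  assumes [measurable]: "f \<in> borel_measurable borel"
  shows "green j (\<lambda>s. c * f s) = c * green j f"
  unfolding green_def by (simp add: mult.assoc nn_integral_cmult)

lemma exit_cmult:
  assumes [measurable]: "f \<in> borel_measurable borel"
  shows "exit j (\<lambda>s. c * f s) = c * exit j f"
  unfolding exit_def by (simp add: mult.assoc nn_integral_cmult)

lemma nn_integral_next_step:
  assumes [measurable]: "f \<in> borel_measurable borel"
  shows "(\<integral>\<^sup>+w. f (walk (Suc j) w) * indicator {w. stays_neg j w} w \<partial>paths)
    = green j (\<lambda>s. \<integral>\<^sup>+z. f (s + z) \<partial>L)"
proof -
  have "(\<integral>\<^sup>+w. f (walk (Suc j) w) * indicator {w. stays_neg j w} w \<partial>paths) =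
    (\<integral>\<^sup>+w. (\<integral>\<^sup>+y. f (walk j w + y) * indicator {w. stays_neg j w} w \<partial>L) \<partial>paths)"
    by (subst nn_integral_PiM_resample[OF prob_space_axioms, where u = j])
      (simp_all add: walk_Suc walk_upd stays_neg_upd indicator_def)
  also have "\<dots> = green j (\<lambda>s. \<integral>\<^sup>+z. f (s + z) \<partial>L)"
    unfolding green_def by (intro nn_integral_cong nn_integral_multc) measurable
  finally show ?thesis .
qed

text \<open>The balance equation behind the bounds on the renewal function: after one more step the
  path either is still below 0 or has just exited. It is tested below with constants, indicators, a
  Lyapunov function and exponentials.\<close>

lemma green_Suc_add_exit:
  assumes [measurable]: "f \<in> borel_measurable borel"
  shows "green (Suc j) f + exit j f = green j (\<lambda>s. \<integral>\<^sup>+z. f (s + z) \<partial>L)"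
proof -
  have "green (Suc j) f + exit j f =
    (\<integral>\<^sup>+w. f (walk (Suc j) w) * indicator {w. stays_neg (Suc j) w} w
       + f (walk (Suc j) w) * indicator {w. stays_neg j w \<and> walk (Suc j) w \<ge> 0} w \<partial>paths)"
    unfolding green_def exit_def by (intro nn_integral_add[symmetric]) measurable
  also have "\<dots> = (\<integral>\<^sup>+w. f (walk (Suc j) w) * indicator {w. stays_neg j w} w \<partial>paths)"
    by (intro nn_integral_cong) (auto simp: stays_neg_Suc split: split_indicator)
  also have "\<dots> = green j (\<lambda>s. \<integral>\<^sup>+z. f (s + z) \<partial>L)"
    by (rule nn_integral_next_step) simp
  finally show ?thesis .
qed

lemma sum_exit_add_green: "(\<Sum>j<n. exit j (\<lambda>_. 1)) + green n (\<lambda>_. 1) = 1"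
proof (induction n)
  case 0
  then show ?case by (simp add: green_0)
next
  case (Suc n)
  have "green (Suc n) (\<lambda>_. 1) + exit n (\<lambda>_. 1) = green n (\<lambda>_. 1)"
    using green_Suc_add_exit[of "\<lambda>_. 1" n] emeasure_space_1 by simp
  moreover have "(\<Sum>j<Suc n. exit j (\<lambda>_. 1)) + green (Suc n) (\<lambda>_. 1)
      = (\<Sum>j<n. exit j (\<lambda>_. 1)) + (green (Suc n) (\<lambda>_. 1) + exit n (\<lambda>_. 1))"
    by (simp add: add_ac)
  ultimately show ?case
    using Suc by simp
qed

lemma sum_exit_le_1: "(\<Sum>j<n. exit j (\<lambda>_. 1)) \<le> 1"
proof -
  have "(\<Sum>j<n. exit j (\<lambda>_. 1)) \<le> (\<Sum>j<n. exit j (\<lambda>_. 1)) + green n (\<lambda>_. 1)"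
    by (rule add_increasing2) auto
  then show ?thesis
    by (simp only: sum_exit_add_green)
qed

definition renew :: "real \<Rightarrow> ennreal" where
  "renew x = (\<Sum>j. green j (indicator {- x..}))"

lemma renew_ge_1: "x \<ge> 0 \<Longrightarrow> renew x \<ge> 1"
  using sum_le_suminf[of "\<lambda>j. green j (indicator {- x..})" "{0}"] by (simp add: renew_def green_0)

lemma renew_mono: "x \<le> y \<Longrightarrow> renew x \<le> renew y"
  unfolding renew_def by (intro suminf_le green_mono) (auto split: split_indicator)

lemma mono_borel_measurable_ennreal:
  fixes f :: "real \<Rightarrow> ennreal"
  assumes "mono f"
  shows "f \<in> borel_measurable borel"
proof (rule borel_measurableI_greater)
  fix y
  have "is_interval {x. y < f x}"
    unfolding is_interval_1 using assms by (auto simp: mono_def) (meson dual_order.strict_trans1)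
  then show "{x \<in> space borel. y < f x} \<in> sets borel"
    using real_interval_borel_measurable by simp
qed

lemma measurable_renew [measurable]: "renew \<in> borel_measurable borel"
  by (intro mono_borel_measurable_ennreal monoI renew_mono)

text \<open>
  Performing the step from \<open>x\<close> last instead of first, the sum becomes that of \<open>renew x\<close> up to the
  summand for \<open>j = 0\<close> and the probability of ever exiting.
\<close>

lemma renew_superharmonic:
  "(\<integral>\<^sup>+z. renew (x + z) * indicator {0..} (x + z) \<partial>L) \<le> renew x" if x: "x \<ge> 0"
proof -
  let ?f = "indicator {- x..} :: real \<Rightarrow> ennreal"
  interpret paths: prob_space paths
    by (rule prob_space_paths)
  interpret pair_sigma_finite L paths ..
  have [measurable]: "(\<lambda>z. green j (indicator {- (x + z)..})) \<in> borel_measurable L" for j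
  proof -
    have "mono (\<lambda>z. green j (indicator {- (x + z)..}))"
      by (intro monoI green_mono) (auto split: split_indicator)
    then show ?thesis
      using mono_borel_measurable_ennreal by measurable
  qed
  have *: "(\<integral>\<^sup>+z. green j (indicator {- (x + z)..}) * indicator {0..} (x + z) \<partial>L)
      \<le> green (Suc j) ?f + exit j (\<lambda>_. 1)" for j
  proof -
    \<comment> \<open>Nothing is lost here: for x + z < 0 the Green term vanishes, because the path
      stays at or below 0.\<close>
    have "(\<integral>\<^sup>+z. green j (indicator {- (x + z)..}) * indicator {0..} (x + z) \<partial>L)
        \<le> (\<integral>\<^sup>+z. green j (indicator {- (x + z)..}) \<partial>L)"
      by (intro nn_integral_mono) (auto split: split_indicator)
    also have "\<dots> = (\<integral>\<^sup>+z. (\<integral>\<^sup>+w. ?f (walk j w + z) * indicator {w. stays_neg j w} w \<partial>paths) \<partial>L)"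
      unfolding green_def by (intro nn_integral_cong) (auto split: split_indicator)
    also have "\<dots> = (\<integral>\<^sup>+w. (\<integral>\<^sup>+z. ?f (walk j w + z) * indicator {w. stays_neg j w} w \<partial>L) \<partial>paths)"
      by (rule Fubini'[symmetric]) measurable
    also have "\<dots> = green j (\<lambda>s. \<integral>\<^sup>+z. ?f (s + z) \<partial>L)"
      unfolding green_def by (intro nn_integral_cong nn_integral_multc) measurable
    also have "\<dots> = green (Suc j) ?f + exit j ?f"
      by (rule green_Suc_add_exit[symmetric]) measurable
    also have "\<dots> \<le> green (Suc j) ?f + exit j (\<lambda>_. 1)"
      by (intro add_left_mono exit_mono) (auto split: split_indicator)
    finally show ?thesis .
  qed
  have "(\<integral>\<^sup>+z. renew (x + z) * indicator {0..} (x + z) \<partial>L) =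
      (\<Sum>j. \<integral>\<^sup>+z. green j (indicator {- (x + z)..}) * indicator {0..} (x + z) \<partial>L)"
    unfolding renew_def ennreal_suminf_multc[symmetric] by (rule nn_integral_suminf) measurable
  also have "\<dots> \<le> (\<Sum>j. green (Suc j) ?f + exit j (\<lambda>_. 1))"
    by (intro suminf_le *) auto
  also have "\<dots> = (\<Sum>j. green (Suc j) ?f) + (\<Sum>j. exit j (\<lambda>_. 1))"
    by (rule suminf_add[symmetric]) auto
  also have "\<dots> \<le> (\<Sum>j. green (Suc j) ?f) + 1"
    by (intro add_left_mono suminf_le_const sum_exit_le_1) auto
  also have "\<dots> = renew x"
    unfolding renew_def using suminf_offset[of "\<lambda>j. green j ?f" 1] x by (simp add: green_0 add.commute)
  finally show ?thesis .
qed

section \<open>Linear growth of the renewal function\<close>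

lemma green_exp_summable: "\<exists>C::real. C > 0 \<and> (\<Sum>j. green j (\<lambda>s. ennreal (exp (l * s)))) \<le> ennreal C"
proof -
  obtain a k where ak: "0 < a" "a \<le> 1 / 2" "0 < k" and lyap: "\<And>s. s \<le> 0 \<Longrightarrow>
      (\<integral>\<^sup>+z. ennreal (1 - a * exp (l * (s + z))) * indicator {..0} (s + z) \<partial>L)
        + ennreal (k * exp (l * s)) \<le> ennreal (1 - a * exp (l * s))"
    using lyapunov_left by blast
  let ?W = "\<lambda>s. ennreal (1 - a * exp (l * s))"
  \<comment> \<open>The cut-off keeps s = 0, as in \<open>lyapunov_left\<close>, so a return exactly
    to 0 still contributes to \<open>exit j ?W0\<close>. This contribution is nonnegative and is
    added to the left side.\<close>
  let ?W0 = "\<lambda>s. ?W s * indicator {..0} s"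
  let ?e = "\<lambda>s. ennreal (exp (l * s))"
  have step: "green (Suc j) ?W + ennreal k * green j ?e \<le> green j ?W" for j
  proof -
    have "green (Suc j) ?W \<le> green (Suc j) ?W0 + exit j ?W0"
      by (rule add_increasing2) (auto intro!: green_mono)
    also have "\<dots> = green j (\<lambda>s. \<integral>\<^sup>+z. ?W0 (s + z) \<partial>L)"
      by (rule green_Suc_add_exit) measurable
    finally have "green (Suc j) ?W + ennreal k * green j ?e
        \<le> green j (\<lambda>s. \<integral>\<^sup>+z. ?W0 (s + z) \<partial>L) + green j (\<lambda>s. ennreal k * ?e s)"
      by (simp add: green_cmult add_right_mono)
    also have "\<dots> = green j (\<lambda>s. (\<integral>\<^sup>+z. ?W0 (s + z) \<partial>L) + ennreal k * ?e s)"
      by (rule green_add[symmetric]) measurable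
    also have "\<dots> \<le> green j ?W"
      using lyap ak by (intro green_mono) (simp add: ennreal_mult')
    finally show ?thesis .
  qed
  \<comment> \<open>Telescoping: the Lyapunov function starts at 1 - a and each step pays k times
    the Green term, so all payments together are at most 1.\<close>
  have sum: "green n ?W + ennreal k * (\<Sum>j<n. green j ?e) \<le> 1" for n
  proof (induction n)
    case 0
    then show ?case using ak by (simp add: green_0)
  next
    case (Suc n)
    have "green (Suc n) ?W + ennreal k * (\<Sum>j<Suc n. green j ?e) =
      (green (Suc n) ?W + ennreal k * green n ?e) + ennreal k * (\<Sum>j<n. green j ?e)"
      by (simp add: distrib_left add_ac)
    also have "\<dots> \<le> green n ?W + ennreal k * (\<Sum>j<n. green j ?e)"
      by (intro add_right_mono step)
    finally show ?case
      using Suc by simp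
  qed
  have "(\<Sum>j. green j ?e) \<le> ennreal (1 / k)"
  proof (intro suminf_le_const)
    fix n
    have "ennreal k * (\<Sum>j<n. green j ?e) \<le> 1"
      by (rule order_trans[OF _ sum[of n]]) simp
    then have "ennreal (1 / k) * (ennreal k * (\<Sum>j<n. green j ?e)) \<le> ennreal (1 / k) * 1"
      by (intro mult_left_mono) auto
    then show "(\<Sum>j<n. green j ?e) \<le> ennreal (1 / k)"
      using ak by (simp add: mult.assoc[symmetric] ennreal_mult'[symmetric])
  qed auto
  then show ?thesis
    using ak by (intro exI[of _ "1 / k"]) auto
qed

text \<open>The exit term is at most the exponential moment of the whole step, which is a fixed
  multiple of exp(l s) at the position s before the step. Summability is thus inherited from the
  Green terms.\<close>

lemma exit_exp_summable: "\<exists>C::real. C > 0 \<and> (\<Sum>j. exit j (\<lambda>s. ennreal (exp (l * s)))) \<le> ennreal C"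
proof -
  let ?e = "\<lambda>s. ennreal (exp (l * s))"
  obtain C :: real where C: "C > 0" "(\<Sum>j. green j ?e) \<le> ennreal C"
    using green_exp_summable by blast
  define m where "m = expectation (\<lambda>z. exp (l * z))"
  have m: "m > 1"
    using exp_moment_gt_1 by (simp add: m_def)
  have *: "exit j ?e \<le> ennreal m * green j ?e" for j
  proof -
    have "exit j ?e \<le> green (Suc j) ?e + exit j ?e"
      by (rule add_increasing) auto
    also have "\<dots> = green j (\<lambda>s. \<integral>\<^sup>+z. ?e (s + z) \<partial>L)"
      by (rule green_Suc_add_exit) measurable
    also have "(\<lambda>s. \<integral>\<^sup>+z. ?e (s + z) \<partial>L) = (\<lambda>s. ennreal m * ?e s)"
      using exp_integrable[of l] l
      by (simp add: distrib_left exp_add ennreal_mult nn_integral_cmult nn_integral_eq_integral m_def mult.commute)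
    also have "green j \<dots> = ennreal m * green j ?e"
      by (rule green_cmult) measurable
    finally show ?thesis .
  qed
  have "(\<Sum>j. exit j ?e) \<le> (\<Sum>j. ennreal m * green j ?e)"
    by (intro suminf_le *) auto
  also have "\<dots> = ennreal m * (\<Sum>j. green j ?e)"
    by simp
  also have "\<dots> \<le> ennreal m * ennreal C"
    using C by (intro mult_left_mono) auto
  also have "\<dots> = ennreal (m * C)"
    using m by (simp add: ennreal_mult')
  finally show ?thesis
    using m C by (intro exI[of _ "m * C"]) auto
qed

text \<open>
  Evaluating \<open>green j\<close> of the exponential after one more step gives the Wiener--Hopf type bound
  \<open>(E e\<^bsup>hz\<^esup> - 1) \<Sum> green j (e\<^bsup>hs\<^esup>) \<le> \<Sum> exit j (e\<^bsup>hs\<^esup> - 1)\<close>: the left factor is of order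
  \<open>h\<^sup>2\<close> as the walk is centred, the right side of order \<open>h\<close> as overshoots have exponential moments.
\<close>

lemma green_exp_bound:
  "\<exists>C::real. C > 0 \<and> (\<forall>h. 0 < h \<and> h \<le> l / 2 \<longrightarrow>
    (\<Sum>j. green j (\<lambda>s. ennreal (exp (h * s)))) \<le> ennreal (C / h))"
proof -
  obtain C :: real where C: "C > 0" "(\<Sum>j. exit j (\<lambda>s. ennreal (exp (l * s)))) \<le> ennreal C"
    using exit_exp_summable by blast
  obtain k where k: "k > 0" and moment: "\<And>h. h > 0 \<Longrightarrow> integrable L (\<lambda>z. exp (h * z)) \<Longrightarrow>
      1 + k * h\<^sup>2 \<le> expectation (\<lambda>z. exp (h * z))"
    using exp_moment_ge by blast
  have "(\<Sum>j. green j (\<lambda>s. ennreal (exp (h * s)))) \<le> ennreal (2 * C / (l * k) / h)"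
    if h: "0 < h" "h \<le> l / 2" for h
  proof (intro suminf_le_const)
    fix n
    let ?e = "\<lambda>s. ennreal (exp (h * s))"
    let ?d = "\<lambda>s. ennreal (max 0 (exp (h * s) - 1))"
    define m where "m = expectation (\<lambda>z. exp (h * z))"
    define q where "q = (\<Sum>j<n. green j ?e)"
    define x where "x = (\<Sum>j<n. exit j ?d)"
    have int: "integrable L (\<lambda>z. exp (h * z))"
      using h l by (intro exp_integrable) auto
    then have m: "1 + k * h\<^sup>2 \<le> m"
      unfolding m_def using h by (intro moment)
    have le_1: "?e s \<le> 1" if "s \<le> 0" for s
      using that h by (simp add: mult_nonneg_nonpos)
    have green_le: "green j ?e \<le> green j (\<lambda>_. 1)" for j
      by (rule green_mono) (rule le_1)
    have green_1: "green j (\<lambda>_. 1) \<le> 1" for j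
    proof -
      have "green j (\<lambda>_. 1) \<le> (\<Sum>i<j. exit i (\<lambda>_. 1)) + green j (\<lambda>_. 1)"
        by (rule add_increasing) auto
      then show ?thesis
        by (simp only: sum_exit_add_green)
    qed
    have "green j ?e \<le> 1" for j
      using green_le green_1 order_trans by blast
    \<comment> \<open>Working with partial sums keeps q finite, so that it can be cancelled
      below.\<close>
    then have "q \<le> (\<Sum>j<n. 1)"
      unfolding q_def by (intro sum_mono)
    then have q_fin: "q \<noteq> \<top>"
      by (auto simp: top_unique)
    have step: "green (Suc j) ?e + exit j ?e = ennreal m * green j ?e" for j
    proof -
      have "green (Suc j) ?e + exit j ?e = green j (\<lambda>s. \<integral>\<^sup>+z. ?e (s + z) \<partial>L)"
        by (rule green_Suc_add_exit) measurable
      also have "(\<lambda>s. \<integral>\<^sup>+z. ?e (s + z) \<partial>L) = (\<lambda>s. ennreal m * ?e s)"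
        using int
        by (simp add: distrib_left exp_add ennreal_mult nn_integral_cmult nn_integral_eq_integral m_def mult.commute)
      also have "green j \<dots> = ennreal m * green j ?e"
        by (rule green_cmult) measurable
      finally show ?thesis .
    qed
    \<comment> \<open>The unit parts of the exit terms, together with \<open>green n\<close>, sum to
      exactly 1. This cancels the initial term \<open>green 0 ?e\<close> = 1, and what survives is
      of order h.\<close>
    have exit_split: "exit j ?e \<le> exit j (\<lambda>_. 1) + exit j ?d" for j
    proof -
      have "exit j ?e \<le> exit j (\<lambda>s. 1 + ?d s)"
      proof (rule exit_mono)
        fix s :: real
        have "?e s \<le> ennreal (1 + max 0 (exp (h * s) - 1))"
          by (intro ennreal_leI) simp
        also have "\<dots> = 1 + ?d s"
          by (subst ennreal_plus) auto
        finally show "?e s \<le> 1 + ?d s" .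
      qed
      also have "\<dots> = exit j (\<lambda>_. 1) + exit j ?d"
        by (rule exit_add) measurable
      finally show ?thesis .
    qed
    have "ennreal m * q + 1 = (\<Sum>j<n. green (Suc j) ?e) + 1 + (\<Sum>j<n. exit j ?e)"
      unfolding q_def sum_distrib_left by (simp add: step[symmetric] sum.distrib add_ac)
    also have "(\<Sum>j<n. green (Suc j) ?e) + 1 = q + green n ?e"
    proof -
      have "(\<Sum>j<Suc n. green j ?e) = green 0 ?e + (\<Sum>j<n. green (Suc j) ?e)"
        by (rule sum.lessThan_Suc_shift)
      then show ?thesis
        by (simp add: q_def green_0 add_ac)
    qed
    also have "q + green n ?e + (\<Sum>j<n. exit j ?e)
        \<le> q + green n (\<lambda>_. 1) + (\<Sum>j<n. exit j (\<lambda>_. 1) + exit j ?d)"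
      by (intro add_mono sum_mono exit_split green_le order_refl)
    also have "\<dots> = q + ((\<Sum>j<n. exit j (\<lambda>_. 1)) + green n (\<lambda>_. 1)) + x"
      by (simp add: sum.distrib x_def add_ac)
    also have "\<dots> = (q + 1) + x"
      by (simp only: sum_exit_add_green)
    finally have "ennreal m * q + 1 \<le> (q + 1) + x" .
    moreover have "(q + 1) + ennreal (k * h\<^sup>2) * q = ennreal (1 + k * h\<^sup>2) * q + 1"
      using k by (simp add: distrib_right add_ac)
    moreover have "ennreal (1 + k * h\<^sup>2) * q + 1 \<le> ennreal m * q + 1"
      using m by (intro add_right_mono mult_right_mono ennreal_leI) auto
    ultimately have "(q + 1) + ennreal (k * h\<^sup>2) * q \<le> (q + 1) + x"
      by (metis order_trans)
    then have main: "ennreal (k * h\<^sup>2) * q \<le> x"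
      using q_fin by (simp only: ennreal_add_left_cancel_le) simp
    \<comment> \<open>As h <= l / 2, half of the exponent l pays for exp(h s) and the other half for
      the factor s. A single factor h remains, and division by k h^2 gives the order 1 / h.\<close>
    have d_le: "?d s \<le> ennreal (2 * h / l) * ennreal (exp (l * s))" if "s \<ge> 0" for s
    proof -
      have "exp (h * s) - 1 \<le> h * s * exp (h * s)"
        using exp_ge_add_one_self[of "- (h * s)"] by (simp add: exp_minus field_simps)
      also have "\<dots> \<le> h * s * exp (l / 2 * s)"
        using that h mult_right_mono[of h "l / 2" s] by (intro mult_left_mono) auto
      also have "\<dots> = 2 * h / l * (l / 2 * s) * exp (l / 2 * s)"
        using l by simp
      also have "\<dots> \<le> 2 * h / l * exp (l / 2 * s) * exp (l / 2 * s)"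
      proof (intro mult_right_mono mult_left_mono)
        show "l / 2 * s \<le> exp (l / 2 * s)"
          using exp_ge_add_one_self[of "l / 2 * s"] by linarith
      qed (use l h in auto)
      also have "\<dots> = 2 * h / l * exp (l * s)"
        by (simp add: mult.assoc mult_exp_exp)
      finally show ?thesis
        using h l by (auto simp: ennreal_mult'[symmetric] intro!: ennreal_leI)
    qed
    have "x \<le> (\<Sum>j<n. exit j (\<lambda>s. ennreal (2 * h / l) * ennreal (exp (l * s))))"
      unfolding x_def by (intro sum_mono exit_mono d_le)
    also have "\<dots> = ennreal (2 * h / l) * (\<Sum>j<n. exit j (\<lambda>s. ennreal (exp (l * s))))"
      by (simp add: exit_cmult sum_distrib_left)
    also have "\<dots> \<le> ennreal (2 * h / l) * ennreal C"
      by (intro mult_left_mono order_trans[OF sum_le_suminf C(2)]) auto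
    also have "\<dots> = ennreal (2 * h / l * C)"
      using h l by (simp add: ennreal_mult'[symmetric])
    finally have "ennreal (k * h\<^sup>2) * q \<le> ennreal (2 * h / l * C)"
      using main by simp
    then have "ennreal (1 / (k * h\<^sup>2)) * (ennreal (k * h\<^sup>2) * q)
        \<le> ennreal (1 / (k * h\<^sup>2)) * ennreal (2 * h / l * C)"
      by (intro mult_left_mono) auto
    moreover have "ennreal (1 / (k * h\<^sup>2)) * (ennreal (k * h\<^sup>2) * q) = q"
      using k h by (simp add: mult.assoc[symmetric] ennreal_mult'[symmetric])
    moreover have "ennreal (1 / (k * h\<^sup>2)) * ennreal (2 * h / l * C) = ennreal (1 / (k * h\<^sup>2) * (2 * h / l * C))"
      using k h l C by (intro ennreal_mult[symmetric]) auto
    moreover have "1 / (k * h\<^sup>2) * (2 * h / l * C) = 2 * C / (l * k) / h"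
      using k h by (simp add: power2_eq_square)
    ultimately show "q \<le> ennreal (2 * C / (l * k) / h)"
      by simp
  qed auto
  then show ?thesis
    using C k l by (intro exI[of _ "2 * C / (l * k)"]) auto
qed

text \<open>An exponential Markov bound for the Green function: exp(1 + h s) is at least 1 for s >=
  - x once h x <= 1, and h of order 1 / x turns the bound C / h into a linear one.\<close>

lemma renew_linear: "\<exists>C::real. C \<ge> 1 \<and> (\<forall>x\<ge>0. renew x \<le> ennreal (C * (1 + x)))"
proof -
  obtain C :: real where C: "C > 0" and bound: "\<And>h. 0 < h \<Longrightarrow> h \<le> l / 2 \<Longrightarrow>
      (\<Sum>j. green j (\<lambda>s. ennreal (exp (h * s)))) \<le> ennreal (C / h)"
    using green_exp_bound by blast
  define D where "D = max 1 (exp 1 * C * (2 / l))"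
  have D: "D \<ge> 1" "exp 1 * C * (2 / l) \<le> D"
    by (auto simp: D_def)
  have "renew x \<le> ennreal (D * (1 + x))" if x: "x \<ge> 0" for x
  proof -
    \<comment> \<open>Chosen to satisfy h <= l / 2 and h x <= 1 at once, also for x near 0.\<close>
    define h where "h = 1 / (x + 2 / l)"
    have pos: "0 < x + 2 / l"
      using l x by (intro add_nonneg_pos) auto
    have "h \<le> 1 / (2 / l)"
      unfolding h_def using l x pos by (intro divide_left_mono) auto
    moreover have "h * x \<le> 1"
      unfolding h_def using l pos by (simp add: divide_le_eq_1)
    moreover have "0 < h"
      using pos by (simp add: h_def)
    ultimately have h: "0 < h" "h \<le> l / 2" "h * x \<le> 1"
      by simp_all
    have "indicator {- x..} s \<le> ennreal (exp 1) * ennreal (exp (h * s))" for s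
    proof (cases "s \<ge> - x")
      case True
      then have "h * (- x) \<le> h * s"
        using h by (intro mult_left_mono) auto
      then have "0 \<le> 1 + h * s"
        using h by simp
      then show ?thesis
        using True by (simp add: ennreal_mult'[symmetric] mult_exp_exp)
    qed simp
    then have "renew x \<le> (\<Sum>j. green j (\<lambda>s. ennreal (exp 1) * ennreal (exp (h * s))))"
      unfolding renew_def by (intro suminf_le green_mono) auto
    also have "\<dots> = ennreal (exp 1) * (\<Sum>j. green j (\<lambda>s. ennreal (exp (h * s))))"
      by (simp add: green_cmult)
    also have "\<dots> \<le> ennreal (exp 1) * ennreal (C / h)"
      using h by (intro mult_left_mono bound) auto
    also have "\<dots> = ennreal (exp 1 * C * (x + 2 / l))"
      by (simp add: ennreal_mult'[symmetric] h_def mult.assoc)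
    also have "\<dots> \<le> ennreal (D * (1 + x))"
    proof (rule ennreal_leI)
      have "x \<le> 2 / l * x"
        using l x mult_right_mono[of 1 "2 / l" x] by (simp add: le_divide_eq)
      then have "exp 1 * C * (x + 2 / l) \<le> exp 1 * C * (2 / l * x + 2 / l)"
        using C by (intro mult_left_mono) auto
      also have "\<dots> = exp 1 * C * (2 / l) * (1 + x)"
        by (simp add: algebra_simps add_divide_distrib)
      also have "\<dots> \<le> D * (1 + x)"
        using D x by (intro mult_right_mono) auto
      finally show "exp 1 * C * (x + 2 / l) \<le> D * (1 + x)" .
    qed
    finally show ?thesis .
  qed
  then show ?thesis
    using D by blast
qed

end

section \<open>One step of the branching random walk\<close>

definition point_sum :: "(real \<Rightarrow> ennreal) \<Rightarrow> (nat \<Rightarrow> ereal) \<Rightarrow> ennreal" where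
  "point_sum f y = (\<Sum>i. if y i = \<infinity> then 0 else f (real_of_ereal (y i)))"

lemma measurable_point_sum [measurable]:
  assumes [measurable]: "f \<in> borel_measurable borel"
  shows "point_sum f \<in> borel_measurable (\<Pi>\<^sub>M i\<in>UNIV. borel)"
  unfolding point_sum_def by measurable

lemma partial_sum_le_point_sum:
  "(\<Sum>i<n. if y i = \<infinity> then 0 else f (real_of_ereal (y i))) \<le> point_sum f y"
  unfolding point_sum_def by (rule sum_le_suminf) auto

lemma exp_ennreal_ge: "ennreal (exp t) \<le> exp_ennreal a" if "ennreal t \<le> a" "0 \<le> t"
proof (cases a rule: ennreal_cases)
  case (real b)
  then have "t \<le> b"
    using that by simp
  then show ?thesis
    using real by (simp add: exp_ennreal_def)
qed (simp add: exp_ennreal_def)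

lemma exp_le_quadratic: "exp t \<le> 1 + t + t\<^sup>2 * exp t" if "t \<ge> 0" for t :: real
proof -
  have "exp t - 1 \<le> t * exp t"
    using exp_ge_add_one_self[of "- t"] by (simp add: exp_minus field_simps)
  then have "t * (exp t - 1) \<le> t * (t * exp t)"
    using that by (rule mult_left_mono)
  then have "t * exp t \<le> t + t\<^sup>2 * exp t"
    by (simp add: algebra_simps power2_eq_square)
  then show ?thesis
    using \<open>exp t - 1 \<le> t * exp t\<close> by simp
qed

lemma square_le_exp: "t\<^sup>2 \<le> 2 * exp t" if "t \<ge> 0" for t :: real
  using exp_lower_Taylor_quadratic[OF that] that by simp

lemma one_plus_square_le_exp: "(1 + x)\<^sup>2 \<le> 16 * exp (x / 2)" if "x \<ge> 0" for x :: real
proof -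
  have "1 + x \<le> 4 * exp (x / 4)"
    using exp_ge_add_one_self[of "x / 4"] by linarith
  then have "(1 + x)\<^sup>2 \<le> (4 * exp (x / 4))\<^sup>2"
    using that by (intro power_mono) auto
  also have "\<dots> = 16 * exp (x / 2)"
    by (simp add: power_mult_distrib exp_double[symmetric])
  finally show ?thesis .
qed

text \<open>\<open>N\<close> is the law of one displacement family and \<open>L\<close> the step law
  of the walk; \<open>many_to_one\<close> is the link between them.\<close>

locale branching_step = step_law L l for L :: "real measure" and l :: real +
  fixes N :: "(nat \<Rightarrow> ereal) measure" and d :: real
  assumes prob_N: "prob_space N"
    and sets_N [measurable_cong]: "sets N = sets (\<Pi>\<^sub>M i\<in>UNIV. borel)"
    and many_to_one: "\<And>f. f \<in> borel_measurable borel \<Longrightarrow>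
      (\<integral>\<^sup>+y. point_sum (\<lambda>v. f v * ennreal (exp (- v))) y \<partial>N) = (\<integral>\<^sup>+z. f z \<partial>L)"
    and d: "0 < d"
    and exp_moment: "(\<integral>\<^sup>+y. exp_ennreal (ennreal d * point_sum (\<lambda>v. ennreal ((1 + max v 0) * exp (- v))) y) \<partial>N) < \<infinity>"
begin

definition renew_real :: "real \<Rightarrow> real" where
  "renew_real x = enn2real (renew x)"

lemma measurable_renew_real [measurable]: "renew_real \<in> borel_measurable borel"
  unfolding renew_real_def by measurable

lemma renew_eq_renew_real: "renew x = ennreal (renew_real x)" if "x \<ge> 0"
proof -
  obtain C where "\<forall>x\<ge>0. renew x \<le> ennreal (C * (1 + x))"
    using renew_linear by blast
  then have "renew x \<le> ennreal (C * (1 + x))"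
    using that by simp
  then have "renew x < \<top>"
    using ennreal_less_top le_less_trans by blast
  then show ?thesis
    by (simp add: renew_real_def)
qed

lemma renew_real_ge_1: "renew_real x \<ge> 1" if "x \<ge> 0"
  using renew_ge_1[OF that] by (simp add: renew_eq_renew_real[OF that])

lemma renew_real_linear: "\<exists>C::real. C \<ge> 1 \<and> (\<forall>x\<ge>0. renew_real x \<le> C * (1 + x))"
proof -
  obtain C :: real where C: "C \<ge> 1" "\<forall>x\<ge>0. renew x \<le> ennreal (C * (1 + x))"
    using renew_linear by blast
  have "renew_real x \<le> C * (1 + x)" if "x \<ge> 0" for x
  proof -
    have "ennreal (renew_real x) \<le> ennreal (C * (1 + x))"
      using C(2)[rule_format, OF that] by (simp only: renew_eq_renew_real[OF that])
    then show ?thesis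
      using C(1) that by (subst (asm) ennreal_le_iff) auto
  qed
  then show ?thesis
    using C by blast
qed

text \<open>
  The correction \<open>b (1 - a e\<^bsup>-lx\<^esup>)\<close> to the renewal function makes the exponent strictly superharmonic,
  with a gain \<open>b k e\<^bsup>-lx\<^esup>\<close> that absorbs the second-order term of the exponential.
\<close>

lemma exp_supermartingale_step:
  "\<exists>c>0. \<exists>g. g \<in> borel_measurable borel \<and>
    (\<forall>x\<ge>0. c * (renew_real x * exp (- x)) \<le> g x \<and> g x \<le> 2 * c * (renew_real x * exp (- x))) \<and>
    (\<forall>x\<ge>0. \<forall>n. (\<integral>\<^sup>+y. ennreal (exp (\<Sum>i<n. if y i \<noteq> \<infinity> \<and> 0 \<le> x + real_of_ereal (y i)
      then g (x + real_of_ereal (y i)) else 0)) \<partial>N) \<le> ennreal (exp (g x)))"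
proof -
  interpret N: prob_space N by (rule prob_N)
  obtain a k where ak: "0 < a" "a \<le> 1 / 2" "0 < k" and lyap: "\<And>x. x \<ge> 0 \<Longrightarrow>
      (\<integral>\<^sup>+z. ennreal (1 - a * exp (- (l * (x + z)))) * indicator {0..} (x + z) \<partial>L)
        + ennreal (k * exp (- (l * x))) \<le> ennreal (1 - a * exp (- (l * x)))"
    using lyapunov_right by blast
  obtain C :: real where C: "C \<ge> 1" and renew_real_le: "\<And>x. x \<ge> 0 \<Longrightarrow> renew_real x \<le> C * (1 + x)"
    using renew_real_linear by blast
  define E where "E = enn2real (\<integral>\<^sup>+y. exp_ennreal (ennreal d * point_sum (\<lambda>v. ennreal ((1 + max v 0) * exp (- v))) y) \<partial>N)"
  have E: "E \<ge> 0"
    by (simp add: E_def)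
  \<comment> \<open>The number 512 is 4 * 8 * 16: 4 from the square of \<open>B\<close>, 8 from
    \<open>quad\<close> and 16 from \<open>one_plus_square_le_exp\<close>. The summand 1 ensures
    that \<open>A\<close> is at least 1.\<close>
  define A where "A = 512 * C\<^sup>2 * E / (d\<^sup>2 * k) + 1"
  have A: "A \<ge> 1" "512 * C\<^sup>2 * E / d\<^sup>2 \<le> A * k"
    using E ak d by (auto simp: A_def field_simps)
  \<comment> \<open>The first bound gives b <= 1, hence b W(x) <= 1 <= R(x); the second gives B <= d
    / 2.\<close>
  define c where "c = min (1 / A) (d / (4 * C))"
  have c: "c > 0" "c * A \<le> 1" "2 * c * C \<le> d / 2"
  proof -
    show "c > 0"
      using A d C by (simp add: c_def)
    have "c * A \<le> 1 / A * A"
      using A by (intro mult_right_mono) (auto simp: c_def)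
    then show "c * A \<le> 1"
      using A by simp
    have "2 * C * c \<le> 2 * C * (d / (4 * C))"
      using C by (intro mult_left_mono) (auto simp: c_def)
    then show "2 * c * C \<le> d / 2"
      using C by (simp add: mult_ac)
  qed
  \<comment> \<open>Proportional to c, so that the gain c b k has the order c^2 of the second-order
    term; the choice of \<open>A\<close> then settles the comparison.\<close>
  define b where "b = c * A"
  have b: "0 < b" "b \<le> 1"
    using A c by (auto simp: b_def)
  define W where "W x = 1 - a * exp (- (l * x))" for x
  have W: "0 \<le> W x" "W x \<le> 1" if "x \<ge> 0" for x
  proof -
    have "a * exp (- (l * x)) \<le> 1 / 2 * 1"
      using that l ak by (intro mult_mono) auto
    then show "0 \<le> W x"
      by (simp add: W_def)
  qed (use ak in \<open>simp add: W_def\<close>)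
  have [measurable]: "W \<in> borel_measurable borel"
    unfolding W_def by measurable
  define g where "g x = c * (renew_real x + b * W x) * exp (- x)" for x
  have g_meas [measurable]: "g \<in> borel_measurable borel"
    unfolding g_def by measurable
  have g_bounds: "c * (renew_real x * exp (- x)) \<le> g x" "g x \<le> 2 * c * (renew_real x * exp (- x))" "0 \<le> g x" if x: "x \<ge> 0" for x
  proof -
    have bW: "0 \<le> b * W x" "b * W x \<le> 1"
      using b W[OF x] by (auto intro: mult_le_one)
    have "c * (renew_real x * exp (- x)) = c * renew_real x * exp (- x)"
      by simp
    also have "\<dots> \<le> g x"
      unfolding g_def using c bW by (intro mult_right_mono mult_left_mono) auto
    finally show *: "c * (renew_real x * exp (- x)) \<le> g x" .
    have "g x \<le> c * (2 * renew_real x) * exp (- x)"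
      unfolding g_def using c bW renew_real_ge_1[OF x] by (intro mult_right_mono mult_left_mono) auto
    then show "g x \<le> 2 * c * (renew_real x * exp (- x))"
      by (simp add: mult_ac)
    have "0 \<le> c * (renew_real x * exp (- x))"
      using c renew_real_ge_1[OF x] by simp
    then show "0 \<le> g x"
      using * by simp
  qed
  have step: "(\<integral>\<^sup>+y. ennreal (exp (\<Sum>i<n. if y i \<noteq> \<infinity> \<and> 0 \<le> x + real_of_ereal (y i)
      then g (x + real_of_ereal (y i)) else 0)) \<partial>N) \<le> ennreal (exp (g x))" if x: "x \<ge> 0" for x n
  proof -
    define H where "H y = (\<Sum>i<n. if y i \<noteq> \<infinity> \<and> 0 \<le> x + real_of_ereal (y i)
      then g (x + real_of_ereal (y i)) else 0)" for y
    define X where "X y = (\<Sum>i<n. if y i = \<infinity> then 0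
      else (1 + max (real_of_ereal (y i)) 0) * exp (- real_of_ereal (y i)))" for y
    \<comment> \<open>The factor in the bound of \<open>H\<close> by \<open>X\<close>. The linear
      growth of R and 1 + x + v <= (1 + x) (1 + max v 0) separate the parent's position from the
      child's displacement.\<close>
    define B where "B = 2 * c * C * ((1 + x) * exp (- x))"
    have [measurable]: "H \<in> borel_measurable N" "X \<in> borel_measurable N"
      unfolding H_def X_def by measurable
    have H_nonneg: "0 \<le> H y" for y
      unfolding H_def by (intro sum_nonneg) (auto intro: g_bounds)
    have X_nonneg: "0 \<le> X y" for y
      unfolding X_def by (intro sum_nonneg) auto
    have "(1 + x) * exp (- x) \<le> 1"
      using exp_ge_add_one_self[of x] by (simp add: exp_minus field_simps)
    then have "B \<le> 2 * c * C * 1"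
      unfolding B_def using c C by (intro mult_left_mono) auto
    moreover have "0 \<le> B"
      using c C x by (simp add: B_def)
    ultimately have B: "0 \<le> B" "B \<le> d / 2"
      using c by simp_all
    have HX: "H y \<le> B * X y" for y
    proof -
      have "g (x + v) \<le> B * ((1 + max v 0) * exp (- v))" if "0 \<le> x + v" for v
      proof -
        have "renew_real (x + v) \<le> C * (1 + (x + v))"
          using that by (rule renew_real_le)
        also have "\<dots> \<le> C * ((1 + x) * (1 + max v 0))"
          using C x by (intro mult_left_mono) (auto simp: max_def algebra_simps)
        finally have "2 * c * (renew_real (x + v) * exp (- (x + v)))
            \<le> 2 * c * (C * ((1 + x) * (1 + max v 0)) * exp (- (x + v)))"
          using c by (intro mult_left_mono mult_right_mono) auto
        also have "\<dots> = B * ((1 + max v 0) * exp (- v))"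
          by (simp add: B_def exp_diff exp_minus field_simps)
        finally show ?thesis
          using g_bounds(2)[OF that] by simp
      qed
      then show ?thesis
        unfolding H_def X_def sum_distrib_left using B by (intro sum_mono) auto
    qed
    \<comment> \<open>Half of the exponent d bounds exp(H) and the other half absorbs the square of
      \<open>X\<close>.\<close>
    have quad: "exp (H y) \<le> 1 + H y + B\<^sup>2 * (8 / d\<^sup>2) * exp (d * X y)" for y
    proof -
      have "(H y)\<^sup>2 * exp (H y) \<le> (B * X y)\<^sup>2 * exp (d / 2 * X y)"
      proof (intro mult_mono power_mono)
        show "exp (H y) \<le> exp (d / 2 * X y)"
          using HX[of y] mult_right_mono[OF B(2) X_nonneg[of y]] by simp
      qed (use HX H_nonneg in auto)
      also have "\<dots> = B\<^sup>2 * (4 / d\<^sup>2) * ((d / 2 * X y)\<^sup>2 * exp (d / 2 * X y))"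
        using d by (simp add: power_mult_distrib power_divide)
      also have "\<dots> \<le> B\<^sup>2 * (4 / d\<^sup>2) * ((2 * exp (d / 2 * X y)) * exp (d / 2 * X y))"
        using d X_nonneg[of y] by (intro mult_left_mono mult_right_mono square_le_exp) auto
      also have "\<dots> = B\<^sup>2 * (8 / d\<^sup>2) * exp (d * X y)"
        by (simp add: mult.assoc mult_exp_exp)
      finally show ?thesis
        using exp_le_quadratic[OF H_nonneg[of y]] by simp
    qed
    have E_X: "(\<integral>\<^sup>+y. ennreal (exp (d * X y)) \<partial>N) \<le> ennreal E"
    proof -
      have "ennreal (d * X y) \<le> ennreal d * point_sum (\<lambda>v. ennreal ((1 + max v 0) * exp (- v))) y" for y
      proof -
        have "ennreal (X y) = (\<Sum>i<n. if y i = \<infinity> then 0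
            else ennreal ((1 + max (real_of_ereal (y i)) 0) * exp (- real_of_ereal (y i))))"
          unfolding X_def by (subst sum_ennreal[symmetric], simp, intro sum.cong) auto
        also have "\<dots> \<le> point_sum (\<lambda>v. ennreal ((1 + max v 0) * exp (- v))) y"
          by (rule partial_sum_le_point_sum)
        finally show ?thesis
          using d by (simp add: ennreal_mult' mult_left_mono)
      qed
      then have "(\<integral>\<^sup>+y. ennreal (exp (d * X y)) \<partial>N)
          \<le> (\<integral>\<^sup>+y. exp_ennreal (ennreal d * point_sum (\<lambda>v. ennreal ((1 + max v 0) * exp (- v))) y) \<partial>N)"
        using d X_nonneg by (intro nn_integral_mono exp_ennreal_ge) auto
      then show ?thesis
        using exp_moment by (simp add: E_def)
    qed
    let ?i = "\<lambda>z. indicator {0..} (x + z) :: ennreal"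
    \<comment> \<open>First order: \<open>many_to_one\<close> turns the sum over children into one
      step of the killed walk, for which R is superharmonic and \<open>W\<close> has the drift found
      in \<open>lyapunov_right\<close>.\<close>
    have E_H: "(\<integral>\<^sup>+y. ennreal (H y) \<partial>N) + ennreal (c * exp (- x) * (b * (k * exp (- (l * x))))) \<le> ennreal (g x)"
    proof -
      let ?f = "\<lambda>z. ennreal (c * exp (- x)) * (renew (x + z) * ?i z + ennreal b * (ennreal (W (x + z)) * ?i z))"
      have "(\<integral>\<^sup>+y. ennreal (H y) \<partial>N) \<le> (\<integral>\<^sup>+y. point_sum (\<lambda>v. ?f v * ennreal (exp (- v))) y \<partial>N)"
      proof (rule nn_integral_mono)
        fix y
        have f_eq: "?f v * ennreal (exp (- v)) = (if 0 \<le> x + v then ennreal (g (x + v)) else 0)" for v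
        proof (cases "0 \<le> x + v")
          case True
          then have "?f v = ennreal (c * exp (- x)) * ennreal (renew_real (x + v) + b * W (x + v))"
            using b W[OF True] renew_real_ge_1[OF True] by (simp add: renew_eq_renew_real ennreal_mult ennreal_plus)
          also have "\<dots> * ennreal (exp (- v)) = ennreal (c * exp (- x) * (renew_real (x + v) + b * W (x + v)) * exp (- v))"
            using b c W[OF True] renew_real_ge_1[OF True]
            by (simp add: ennreal_mult del: ennreal_plus)
          also have "c * exp (- x) * (renew_real (x + v) + b * W (x + v)) * exp (- v) = g (x + v)"
            by (simp add: g_def mult_exp_exp)
          finally show ?thesis
            using True by simp
        qed simp
        have "ennreal (H y) = (\<Sum>i<n. if y i = \<infinity> then 0 else ?f (real_of_ereal (y i)) * ennreal (exp (- real_of_ereal (y i))))"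
          unfolding H_def f_eq by (subst sum_ennreal[symmetric], simp add: g_bounds, intro sum.cong) auto
        also have "\<dots> \<le> point_sum (\<lambda>v. ?f v * ennreal (exp (- v))) y"
          by (rule partial_sum_le_point_sum)
        finally show "ennreal (H y) \<le> point_sum (\<lambda>v. ?f v * ennreal (exp (- v))) y" .
      qed
      also have "\<dots> = (\<integral>\<^sup>+z. ?f z \<partial>L)"
        by (rule many_to_one) measurable
      also have "\<dots> = ennreal (c * exp (- x)) * ((\<integral>\<^sup>+z. renew (x + z) * ?i z \<partial>L)
          + ennreal b * (\<integral>\<^sup>+z. ennreal (W (x + z)) * ?i z \<partial>L))"
        by (simp add: nn_integral_cmult nn_integral_add)
      also have "\<dots> \<le> ennreal (c * exp (- x)) * (renew x
          + ennreal b * (\<integral>\<^sup>+z. ennreal (W (x + z)) * ?i z \<partial>L))"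
        by (intro mult_left_mono add_right_mono renew_superharmonic x) auto
      finally have "(\<integral>\<^sup>+y. ennreal (H y) \<partial>N) + ennreal (c * exp (- x) * (b * (k * exp (- (l * x)))))
        \<le> ennreal (c * exp (- x)) * (renew x + ennreal b * (\<integral>\<^sup>+z. ennreal (W (x + z)) * ?i z \<partial>L))
          + ennreal (c * exp (- x)) * (ennreal b * ennreal (k * exp (- (l * x))))"
        using c b ak by (simp add: ennreal_mult add_right_mono)
      also have "\<dots> = ennreal (c * exp (- x)) * (renew x + ennreal b *
          ((\<integral>\<^sup>+z. ennreal (W (x + z)) * ?i z \<partial>L) + ennreal (k * exp (- (l * x)))))"
        by (simp only: distrib_left add.assoc)
      also have "\<dots> \<le> ennreal (c * exp (- x)) * (renew x + ennreal b * ennreal (W x))"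
        using lyap[OF x] unfolding W_def by (intro mult_left_mono add_left_mono) auto
      also have "\<dots> = ennreal (c * exp (- x) * (renew_real x + b * W x))"
        using c b W[OF x] renew_real_ge_1[OF x] by (simp add: renew_eq_renew_real[OF x] ennreal_mult ennreal_plus)
      also have "c * exp (- x) * (renew_real x + b * W x) = g x"
        by (simp add: g_def)
      finally show ?thesis .
    qed
    have gain: "B\<^sup>2 * (8 / d\<^sup>2) * E \<le> c * exp (- x) * (b * (k * exp (- (l * x))))"
    proof -
      have "B\<^sup>2 * (8 / d\<^sup>2) * E = c\<^sup>2 * (32 * C\<^sup>2 * E / d\<^sup>2) * (1 + x)\<^sup>2 * (exp (- x))\<^sup>2"
        by (simp add: B_def power_mult_distrib)
      also have "\<dots> \<le> c\<^sup>2 * (32 * C\<^sup>2 * E / d\<^sup>2) * (16 * exp (x / 2)) * (exp (- x))\<^sup>2"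
        using E x by (intro mult_right_mono mult_left_mono one_plus_square_le_exp) auto
      also have "\<dots> = c\<^sup>2 * (512 * C\<^sup>2 * E / d\<^sup>2) * (exp (x / 2) * (exp (- x))\<^sup>2)"
        by simp
      also have "exp (x / 2) * (exp (- x))\<^sup>2 = exp (- x) * exp (- (x / 2))"
        by (simp add: power2_eq_square mult_exp_exp)
      also have "c\<^sup>2 * (512 * C\<^sup>2 * E / d\<^sup>2) * (exp (- x) * exp (- (x / 2)))
          \<le> c\<^sup>2 * (A * k) * (exp (- x) * exp (- (l * x)))"
        using A ak l x mult_right_mono[OF l(2) x] by (intro mult_mono mult_left_mono) auto
      also have "\<dots> = c * exp (- x) * (b * (k * exp (- (l * x))))"
        by (simp add: b_def power2_eq_square)
      finally show ?thesis .
    qed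
    have "(\<integral>\<^sup>+y. ennreal (exp (H y)) \<partial>N)
        \<le> (\<integral>\<^sup>+y. 1 + ennreal (H y) + ennreal (B\<^sup>2 * (8 / d\<^sup>2)) * ennreal (exp (d * X y)) \<partial>N)"
    proof (rule nn_integral_mono)
      fix y
      have "ennreal (exp (H y)) \<le> ennreal (1 + H y + B\<^sup>2 * (8 / d\<^sup>2) * exp (d * X y))"
        by (intro ennreal_leI quad)
      also have "\<dots> = 1 + ennreal (H y) + ennreal (B\<^sup>2 * (8 / d\<^sup>2)) * ennreal (exp (d * X y))"
        using H_nonneg[of y] by (simp add: ennreal_mult'[symmetric])
      finally show "ennreal (exp (H y)) \<le> 1 + ennreal (H y) + ennreal (B\<^sup>2 * (8 / d\<^sup>2)) * ennreal (exp (d * X y))" .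
    qed
    also have "\<dots> = 1 + (\<integral>\<^sup>+y. ennreal (H y) \<partial>N) + ennreal (B\<^sup>2 * (8 / d\<^sup>2)) * (\<integral>\<^sup>+y. ennreal (exp (d * X y)) \<partial>N)"
      by (simp add: nn_integral_add nn_integral_cmult N.emeasure_space_1)
    also have "\<dots> \<le> 1 + (\<integral>\<^sup>+y. ennreal (H y) \<partial>N) + ennreal (B\<^sup>2 * (8 / d\<^sup>2)) * ennreal E"
      by (intro add_left_mono mult_left_mono E_X) auto
    also have "\<dots> = 1 + (\<integral>\<^sup>+y. ennreal (H y) \<partial>N) + ennreal (B\<^sup>2 * (8 / d\<^sup>2) * E)"
      using E by (subst ennreal_mult) auto
    also have "\<dots> \<le> 1 + (\<integral>\<^sup>+y. ennreal (H y) \<partial>N) + ennreal (c * exp (- x) * (b * (k * exp (- (l * x)))))"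
      by (intro add_left_mono ennreal_leI gain)
    also have "\<dots> \<le> 1 + ennreal (g x)"
      unfolding add.assoc by (intro add_left_mono E_H)
    also have "\<dots> = ennreal (1 + g x)"
      using g_bounds(3)[OF x] by simp
    also have "\<dots> \<le> ennreal (exp (g x))"
      by (intro ennreal_leI exp_ge_add_one_self)
    finally show ?thesis
      unfolding H_def .
  qed
  show ?thesis
    using c g_meas g_bounds step by (intro exI[of _ c] conjI exI[of _ g]) auto
qed

end

section \<open>Convergence of nonnegative supermartingales\<close>

text \<open>
  \<open>crossing a b K Y n\<close> is a pair: the number of completed upcrossings of \<open>[a, b]\<close> up to time \<open>n\<close>,
  stopped at \<open>K\<close>, and whether an upcrossing is under way.
\<close>

definition crossing_step :: "real \<Rightarrow> real \<Rightarrow> nat \<Rightarrow> nat \<times> bool \<Rightarrow> ennreal \<Rightarrow> nat \<times> bool" where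
  "crossing_step a b K s t = (if snd s
     then if t \<ge> ennreal b then (Suc (fst s), False) else s
     else (fst s, t \<le> ennreal a \<and> fst s < K))"

primrec crossing :: "real \<Rightarrow> real \<Rightarrow> nat \<Rightarrow> (nat \<Rightarrow> ennreal) \<Rightarrow> nat \<Rightarrow> nat \<times> bool" where
  "crossing a b K Y 0 = crossing_step a b K (0, False) (Y 0)"
| "crossing a b K Y (Suc n) = crossing_step a b K (crossing a b K Y n) (Y (Suc n))"

text \<open>
  The process \<open>crossing_val\<close> evaluated along the path is a supermartingale as soon as \<open>Y\<close> is one,
  because changing the state only decreases it.
\<close>

definition crossing_val :: "real \<Rightarrow> real \<Rightarrow> nat \<times> bool \<Rightarrow> ennreal \<Rightarrow> ennreal" where
  "crossing_val a b s t = ennreal ((b / a) ^ fst s) * (if snd s then ennreal (1 / a) * t else 1)"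

text \<open>An upcrossing begins when t <= a, where 1 is replaced by t / a <= 1. It ends when t >=
  b, where t / a is replaced by b / a <= t / a.\<close>

lemma crossing_val_step:
  assumes "0 < a" "a < b"
  shows "crossing_val a b (crossing_step a b K s t) t \<le> crossing_val a b s t"
proof -
  obtain k r where s: "s = (k, r)"
    by force
  have 1: "ennreal (1 / a) * t \<le> 1" if "t \<le> ennreal a"
  proof -
    have "ennreal (1 / a) * t \<le> ennreal (1 / a) * ennreal a"
      using that by (intro mult_left_mono) auto
    then show ?thesis
      using assms by (simp add: ennreal_mult'[symmetric])
  qed
  have 2: "ennreal (b / a) \<le> ennreal (1 / a) * t" if "ennreal b \<le> t"
  proof -
    have "ennreal (1 / a) * ennreal b \<le> ennreal (1 / a) * t"
      using that by (intro mult_left_mono) auto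
    then show ?thesis
      using assms by (simp add: ennreal_mult'[symmetric])
  qed
  have "ennreal ((b / a) ^ Suc k) = ennreal ((b / a) ^ k) * ennreal (b / a)"
    using assms by (simp add: ennreal_mult'[symmetric] mult.commute)
  then show ?thesis
    using 1 2 mult_left_mono[of "ennreal (1 / a) * t" 1 "ennreal ((b / a) ^ k)"]
      mult_left_mono[of "ennreal (b / a)" "ennreal (1 / a) * t" "ennreal ((b / a) ^ k)"]
    by (auto simp: crossing_val_def crossing_step_def s)
qed

text \<open>The cap K leaves finitely many states, over which \<open>crossing_prob\<close>
  decomposes.\<close>

lemma crossing_le: "fst (crossing a b K Y n) \<le> K \<and> (snd (crossing a b K Y n) \<longrightarrow> fst (crossing a b K Y n) < K)"
  by (induction n) (auto simp: crossing_step_def)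

lemma crossing_cong: "(\<And>k. k \<le> n \<Longrightarrow> Y k = Y' k) \<Longrightarrow> crossing a b K Y n = crossing a b K Y' n"
  by (induction n) auto

lemma crossing_Suc_unfold: "n > 0 \<Longrightarrow> crossing a b K Y n = crossing_step a b K (crossing a b K Y (n - 1)) (Y n)"
  by (cases n) auto

text \<open>Absorption in (K, False) makes the events in \<open>AE_no_oscillation\<close> increase
  with n.\<close>

lemma crossing_final: "crossing a b K Y m = (K, False)" if "n \<le> m" "crossing a b K Y n = (K, False)"
  using that by (induction rule: dec_induct) (auto simp: crossing_step_def)

lemma crossing_reaches:
  assumes below: "\<And>n. \<exists>m>n. Y m \<le> ennreal a" and above: "\<And>n. \<exists>m>n. Y m \<ge> ennreal b"
  shows "\<exists>n. crossing a b K Y n = (K, False)"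
proof -
  let ?c = "crossing a b K Y"
  have start: "\<exists>n. ?c n = (j, True)" if n: "fst (?c n) = j" "j < K" for n j
  proof (rule ccontr)
    assume no: "\<not> ?thesis"
    have stay: "?c i = (j, False)" if "n \<le> i" for i
      using that
    proof (induction rule: dec_induct)
      case base
      then show ?case
        using n no by (cases "?c n") auto
    next
      case (step i)
      then show ?case
        using no spec[of "\<lambda>n. ?c n \<noteq> (j, True)" "Suc i"] by (auto simp: crossing_step_def)
    qed
    obtain m where "m > n" "Y m \<le> ennreal a"
      using below by blast
    then have "?c m = (j, True)"
      using crossing_Suc_unfold[of m a b K Y] stay[of "m - 1"] n by (simp add: crossing_step_def)
    then show False
      using no by blast
  qed
  have finish: "\<exists>n. ?c n = (Suc j, False)" if n: "?c n = (j, True)" for n j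
  proof (rule ccontr)
    assume no: "\<not> ?thesis"
    have stay: "?c i = (j, True)" if "n \<le> i" for i
      using that
    proof (induction rule: dec_induct)
      case (step i)
      then show ?case
        using no spec[of "\<lambda>n. ?c n \<noteq> (Suc j, False)" "Suc i"] by (auto simp: crossing_step_def)
    qed (rule n)
    obtain m where "m > n" "Y m \<ge> ennreal b"
      using above by blast
    then have "?c m = (Suc j, False)"
      using crossing_Suc_unfold[of m a b K Y] stay[of "m - 1"] by (simp add: crossing_step_def)
    then show False
      using no by blast
  qed
  have "\<exists>n. fst (?c n) = j" if "j \<le> K" for j
    using that
  proof (induction j)
    case 0
    have "fst (?c 0) = 0"
      by (simp add: crossing_step_def)
    then show ?case
      by blast
  next
    case (Suc j)
    then obtain n where "fst (?c n) = j"
      by auto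
    then obtain n' where "?c n' = (Suc j, False)"
      using start finish Suc.prems by (metis Suc_le_lessD)
    then show ?case
      by (metis fst_conv)
  qed
  then obtain n where n: "fst (?c n) = K"
    by blast
  then show ?thesis
    using crossing_le[of a b K Y n] by (intro exI[of _ n]) (auto simp: prod_eq_iff)
qed

text \<open>
  The hypothesis \<open>super\<close> is the supermartingale property for the natural filtration of \<open>Y\<close>.
\<close>

locale nonneg_supermartingale = prob_space M for M :: "'a measure" +
  fixes Y :: "nat \<Rightarrow> 'a \<Rightarrow> ennreal"
  assumes meas [measurable]: "\<And>n. Y n \<in> borel_measurable M"
    and super: "\<And>n A. A \<in> sets M \<Longrightarrow>
      (\<And>w w'. w \<in> A \<Longrightarrow> w' \<in> space M \<Longrightarrow> (\<And>k. k \<le> n \<Longrightarrow> Y k w = Y k w') \<Longrightarrow> w' \<in> A) \<Longrightarrow>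
      (\<integral>\<^sup>+w. Y (Suc n) w * indicator A w \<partial>M) \<le> (\<integral>\<^sup>+w. Y n w * indicator A w \<partial>M)"
begin

lemma measurable_crossing [measurable]:
  "(\<lambda>w. crossing a b K (\<lambda>k. Y k w) n) \<in> M \<rightarrow>\<^sub>M count_space UNIV"
proof (induction n)
  case 0
  have "(\<lambda>w. crossing a b K (\<lambda>k. Y k w) 0) = (\<lambda>w. if Y 0 w \<le> ennreal a \<and> 0 < K then (0, True) else (0, False))"
    by (auto simp: crossing_step_def)
  then show ?case
    by simp
next
  case (Suc n)
  have "(\<lambda>w. crossing_step a b K s (Y (Suc n) w)) \<in> M \<rightarrow>\<^sub>M count_space UNIV" for s
  proof (cases "snd s")
    case False
    then have "(\<lambda>w. crossing_step a b K s (Y (Suc n) w)) =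
        (\<lambda>w. if Y (Suc n) w \<le> ennreal a \<and> fst s < K then (fst s, True) else (fst s, False))"
      by (auto simp: crossing_step_def)
    then show ?thesis
      by simp
  qed (simp add: crossing_step_def)
  from measurable_compose_countable[OF this Suc] show ?case
    by simp
qed

text \<open>A form of Dubins' inequality: \<open>crossing_val\<close> along the path has mean at
  most 1 at all times and equals (b / a)^K in the state (K, False).\<close>

lemma crossing_prob:
  assumes ab: "0 < a" "a < b"
  shows "emeasure M {w \<in> space M. crossing a b K (\<lambda>k. Y k w) n = (K, False)} \<le> ennreal ((a / b) ^ K)"
proof -
  let ?c = "\<lambda>n w. crossing a b K (\<lambda>k. Y k w) n"
  let ?S = "{..K} \<times> (UNIV :: bool set)"
  \<comment> \<open>For a fixed state s the value is a constant or a constant multiple of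
    \<open>Y\<close>, and the event of being in s is determined by \<open>Y\<close> up to time n.
    Hence \<open>super\<close> applies to each piece.\<close>
  have decomp: "(\<integral>\<^sup>+w. crossing_val a b (?c n w) (Y m w) \<partial>M) =
      (\<Sum>s\<in>?S. \<integral>\<^sup>+w. crossing_val a b s (Y m w) * indicator {w \<in> space M. ?c n w = s} w \<partial>M)" for n m
  proof -
    have "crossing_val a b (?c n w) (Y m w) =
        (\<Sum>s\<in>?S. crossing_val a b s (Y m w) * indicator {w \<in> space M. ?c n w = s} w)" if "w \<in> space M" for w
    proof -
      have "?c n w \<in> ?S"
        using crossing_le[of a b K "\<lambda>k. Y k w" n] by (simp add: mem_Times_iff)
      then have "(\<Sum>s\<in>?S. if s = ?c n w then crossing_val a b s (Y m w) else 0)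
          = crossing_val a b (?c n w) (Y m w)"
        by (subst sum.delta) auto
      moreover have "(\<Sum>s\<in>?S. crossing_val a b s (Y m w) * indicator {w \<in> space M. ?c n w = s} w)
          = (\<Sum>s\<in>?S. if s = ?c n w then crossing_val a b s (Y m w) else 0)"
        using that by (intro sum.cong) auto
      ultimately show ?thesis
        by simp
    qed
    then have "(\<integral>\<^sup>+w. crossing_val a b (?c n w) (Y m w) \<partial>M) =
      (\<integral>\<^sup>+w. (\<Sum>s\<in>?S. crossing_val a b s (Y m w) * indicator {w \<in> space M. ?c n w = s} w) \<partial>M)"
      by (intro nn_integral_cong) auto
    also have "\<dots> = (\<Sum>s\<in>?S. \<integral>\<^sup>+w. crossing_val a b s (Y m w) * indicator {w \<in> space M. ?c n w = s} w \<partial>M)"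
      unfolding crossing_val_def by (rule nn_integral_sum) measurable
    finally show ?thesis .
  qed
  have step: "(\<integral>\<^sup>+w. crossing_val a b s (Y (Suc n) w) * indicator {w \<in> space M. ?c n w = s} w \<partial>M)
      \<le> (\<integral>\<^sup>+w. crossing_val a b s (Y n w) * indicator {w \<in> space M. ?c n w = s} w \<partial>M)" for n s
  proof (cases "snd s")
    case True
    have "(\<integral>\<^sup>+w. Y (Suc n) w * indicator {w \<in> space M. ?c n w = s} w \<partial>M)
        \<le> (\<integral>\<^sup>+w. Y n w * indicator {w \<in> space M. ?c n w = s} w \<partial>M)"
    proof (rule super)
      fix w w'
      assume "w \<in> {w \<in> space M. ?c n w = s}" "w' \<in> space M" "\<And>k. k \<le> n \<Longrightarrow> Y k w = Y k w'"
      then show "w' \<in> {w \<in> space M. ?c n w = s}"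
        using crossing_cong[of n "\<lambda>k. Y k w" "\<lambda>k. Y k w'" a b K] by simp
    qed measurable
    then show ?thesis
      using True by (simp add: crossing_val_def mult.assoc nn_integral_cmult mult_left_mono)
  qed (simp add: crossing_val_def)
  have E_le: "(\<integral>\<^sup>+w. crossing_val a b (?c n w) (Y n w) \<partial>M) \<le> 1" for n
  proof (induction n)
    case 0
    have "(\<integral>\<^sup>+w. crossing_val a b (?c 0 w) (Y 0 w) \<partial>M) \<le> (\<integral>\<^sup>+w. crossing_val a b (0, False) (Y 0 w) \<partial>M)"
      by (intro nn_integral_mono) (simp add: crossing_val_step[OF ab])
    then show ?case
      by (simp add: crossing_val_def emeasure_space_1)
  next
    case (Suc n)
    have "(\<integral>\<^sup>+w. crossing_val a b (?c (Suc n) w) (Y (Suc n) w) \<partial>M)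
        \<le> (\<integral>\<^sup>+w. crossing_val a b (?c n w) (Y (Suc n) w) \<partial>M)"
      by (intro nn_integral_mono) (simp add: crossing_val_step[OF ab])
    also have "\<dots> \<le> (\<integral>\<^sup>+w. crossing_val a b (?c n w) (Y n w) \<partial>M)"
      unfolding decomp by (intro sum_mono step)
    finally show ?case
      using Suc by simp
  qed
  have "ennreal ((b / a) ^ K) * emeasure M {w \<in> space M. ?c n w = (K, False)} =
      (\<integral>\<^sup>+w. ennreal ((b / a) ^ K) * indicator {w \<in> space M. ?c n w = (K, False)} w \<partial>M)"
    by (rule nn_integral_cmult_indicator[symmetric]) measurable
  also have "\<dots> \<le> (\<integral>\<^sup>+w. crossing_val a b (?c n w) (Y n w) \<partial>M)"
    by (intro nn_integral_mono) (auto simp: crossing_val_def split: split_indicator)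
  finally have "ennreal ((a / b) ^ K) * (ennreal ((b / a) ^ K) * emeasure M {w \<in> space M. ?c n w = (K, False)})
      \<le> ennreal ((a / b) ^ K) * 1"
    using E_le[of n] by (intro mult_left_mono) auto
  moreover have "ennreal ((a / b) ^ K) * ennreal ((b / a) ^ K) = 1"
    using ab by (simp add: ennreal_mult'[symmetric] power_mult_distrib[symmetric])
  ultimately show ?thesis
    by (simp add: mult.assoc[symmetric])
qed

text \<open>Oscillation completes K upcrossings for every K, and the bound (a / b)^K tends to
  0.\<close>

lemma AE_no_oscillation:
  assumes ab: "0 < a" "a < b"
  shows "AE w in M. \<not> ((\<forall>n. \<exists>m>n. Y m w \<le> ennreal a) \<and> (\<forall>n. \<exists>m>n. Y m w \<ge> ennreal b))"
proof -
  let ?B = "{w \<in> space M. (\<forall>n. \<exists>m>n. Y m w \<le> ennreal a) \<and> (\<forall>n. \<exists>m>n. Y m w \<ge> ennreal b)}"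
  have [measurable]: "?B \<in> sets M"
    by measurable
  have le: "emeasure M ?B \<le> ennreal ((a / b) ^ K)" for K
  proof -
    let ?E = "\<lambda>n. {w \<in> space M. crossing a b K (\<lambda>k. Y k w) n = (K, False)}"
    have E: "range ?E \<subseteq> sets M"
      by auto
    have "emeasure M ?B \<le> emeasure M (\<Union>n. ?E n)"
    proof (rule emeasure_mono)
      show "?B \<subseteq> (\<Union>n. ?E n)"
        using crossing_reaches[where Y = "\<lambda>k. Y k w" for w] by fastforce
    qed (use E in auto)
    also have "\<dots> = (SUP n. emeasure M (?E n))"
      using E by (intro SUP_emeasure_incseq[symmetric]) (auto intro!: monoI intro: crossing_final)
    also have "\<dots> \<le> ennreal ((a / b) ^ K)"
      by (intro SUP_least crossing_prob ab)
    finally show ?thesis .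
  qed
  have "(\<lambda>K. ennreal ((a / b) ^ K)) \<longlonglongrightarrow> ennreal 0"
    using ab by (intro tendsto_ennrealI LIMSEQ_realpow_zero) auto
  then have "emeasure M ?B \<le> ennreal 0"
    using le by (intro LIMSEQ_le_const) auto
  then have "?B \<in> null_sets M"
    by (simp add: null_sets_def)
  then show ?thesis
    by (rule AE_I') auto
qed

text \<open>If liminf and limsup differ, the path oscillates across two rationals between them; the
  smaller one is positive because it exceeds the liminf. The limit may be infinite.\<close>

lemma AE_convergent: "AE w in M. \<exists>t. (\<lambda>n. Y n w) \<longlonglongrightarrow> t"
proof -
  have "AE w in M. \<forall>p q :: rat. 0 < p \<longrightarrow> p < q \<longrightarrow>
    \<not> ((\<forall>n. \<exists>m>n. Y m w \<le> ennreal (of_rat p)) \<and> (\<forall>n. \<exists>m>n. Y m w \<ge> ennreal (of_rat q)))"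
    unfolding AE_all_countable
    by (intro allI AE_impI AE_no_oscillation) (auto simp: of_rat_less)
  then show ?thesis
  proof eventually_elim
    case (elim w)
    have "liminf (\<lambda>n. Y n w) = limsup (\<lambda>n. Y n w)"
    proof (rule ccontr)
      assume "liminf (\<lambda>n. Y n w) \<noteq> limsup (\<lambda>n. Y n w)"
      then have "liminf (\<lambda>n. Y n w) < limsup (\<lambda>n. Y n w)"
        using Liminf_le_Limsup[of sequentially "\<lambda>n. Y n w"] by (simp add: order_less_le)
      then obtain p :: rat where p: "liminf (\<lambda>n. Y n w) < ennreal (of_rat p)" "ennreal (of_rat p) < limsup (\<lambda>n. Y n w)"
        using ennreal_rat_dense by blast
      obtain q :: rat where q: "ennreal (of_rat p) < ennreal (of_rat q)" "ennreal (of_rat q) < limsup (\<lambda>n. Y n w)"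
        using ennreal_rat_dense[OF p(2)] by blast
      have "0 < p"
        using p(1) by (metis ennreal_eq_0_iff not_less_zero not_le of_rat_less_eq of_rat_0)
      moreover have "p < q"
        using q(1) by (metis ennreal_leI not_le of_rat_less_eq)
      moreover have "\<exists>m>n. Y m w \<le> ennreal (of_rat p)" for n
      proof -
        have "(INF m\<in>{Suc n..}. Y m w) \<le> liminf (\<lambda>n. Y n w)"
          unfolding liminf_SUP_INF by (rule SUP_upper) simp
        then have "(INF m\<in>{Suc n..}. Y m w) < ennreal (of_rat p)"
          using p(1) by simp
        then show ?thesis
          unfolding INF_less_iff by (auto simp: Suc_le_eq intro: less_imp_le)
      qed
      moreover have "\<exists>m>n. Y m w \<ge> ennreal (of_rat q)" for n
      proof -
        have "limsup (\<lambda>n. Y n w) \<le> (SUP m\<in>{Suc n..}. Y m w)"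
          unfolding limsup_INF_SUP by (rule INF_lower) simp
        then have "ennreal (of_rat q) < (SUP m\<in>{Suc n..}. Y m w)"
          using q(2) by simp
        then show ?thesis
          unfolding less_SUP_iff by (auto simp: Suc_le_eq intro: less_imp_le)
      qed
      ultimately show False
        using elim by blast
    qed
    then have "(\<lambda>n. Y n w) \<longlonglongrightarrow> limsup (\<lambda>n. Y n w)"
      by (intro Liminf_eq_Limsup) auto
    then show ?case
      by blast
  qed
qed

end

section \<open>The truncated martingale on the space of labelled trees\<close>

lemma ennreal_exp_sum: "ennreal (exp (\<Sum>i\<in>A. f i)) = (\<Prod>i\<in>A. ennreal (exp (f i)))" if "finite A"
  using that by (simp add: exp_sum prod_ennreal)

lemma ancestors_snoc: "ancestors (u @ [i]) = insert (u @ [i]) (ancestors u)"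
proof -
  have "{k. k \<le> length (u @ [i])} = insert (Suc (length u)) {k. k \<le> length u}"
    by auto
  then show ?thesis
    unfolding ancestors_def setcompr_eq_image by (auto intro!: image_eqI)
qed

lemma finite_ancestors: "finite (ancestors u)"
  unfolding ancestors_def setcompr_eq_image by simp

lemma self_in_ancestors: "u \<in> ancestors u"
  by (auto simp: ancestors_def intro: exI[of _ "length u"])

lemma position_Nil [simp]: "position \<xi> [] \<omega> = 0"
  and position_snoc: "position \<xi> (u @ [i]) \<omega> = position \<xi> u \<omega> + real_of_ereal (\<xi> u \<omega> i)"
  by (simp_all add: position_def nth_append)

lemma tree_Nil [simp]: "[] \<in> tree \<xi> \<omega>"
  by (simp add: tree_def)

lemma tree_snoc: "u @ [i] \<in> tree \<xi> \<omega> \<longleftrightarrow> u \<in> tree \<xi> \<omega> \<and> \<xi> u \<omega> i \<noteq> \<infinity>"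
  by (simp add: tree_def All_less_Suc nth_append conj_commute)

definition survives :: "'w displacements \<Rightarrow> real \<Rightarrow> nat list \<Rightarrow> 'w \<Rightarrow> bool" where
  "survives \<xi> x u \<omega> \<longleftrightarrow> u \<in> tree \<xi> \<omega> \<and> 0 \<le> x + min_position \<xi> u \<omega>"

lemma survives_iff:
  "survives \<xi> x u \<omega> \<longleftrightarrow> u \<in> tree \<xi> \<omega> \<and> (\<forall>v\<in>ancestors u. 0 \<le> x + position \<xi> v \<omega>)"
proof -
  have "- x \<le> min_position \<xi> u \<omega> \<longleftrightarrow> (\<forall>v\<in>ancestors u. - x \<le> position \<xi> v \<omega>)"
    unfolding min_position_def using finite_ancestors self_in_ancestors by (subst Min_ge_iff) auto
  then show ?thesis
    unfolding survives_def by (smt (verit))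
qed

lemma survives_Nil [simp]: "survives \<xi> x [] \<omega> \<longleftrightarrow> 0 \<le> x"
  by (simp add: survives_iff ancestors_def)

lemma survives_snoc: "survives \<xi> x (u @ [i]) \<omega> \<longleftrightarrow>
    survives \<xi> x u \<omega> \<and> \<xi> u \<omega> i \<noteq> \<infinity> \<and> 0 \<le> (x + position \<xi> u \<omega>) + real_of_ereal (\<xi> u \<omega> i)"
  by (auto simp: survives_iff ancestors_snoc tree_snoc position_snoc add.assoc)

lemma survives_nonneg: "survives \<xi> x u \<omega> \<Longrightarrow> 0 \<le> x + position \<xi> u \<omega>"
  using self_in_ancestors by (auto simp: survives_iff)

section \<open>The canonical space, whose points are families of displacements\<close>

definition coord :: "(nat list \<Rightarrow> nat \<Rightarrow> ereal) displacements" where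
  "coord u w = w u"

definition words :: "nat \<Rightarrow> nat \<Rightarrow> nat list set" where
  "words m n = {u. set u \<subseteq> {..<m} \<and> length u = n}"

lemma finite_words [simp]: "finite (words m n)"
  unfolding words_def by (rule finite_lists_length_eq) simp

lemma words_0 [simp]: "words m 0 = {[]}"
  by (auto simp: words_def)

lemma length_words: "u \<in> words m n \<Longrightarrow> length u = n"
  by (simp add: words_def)

lemma words_mono: "m \<le> m' \<Longrightarrow> words m n \<subseteq> words m' n"
  by (auto simp: words_def)

lemma sum_words_Suc: "(\<Sum>u\<in>words m (Suc n). f u) = (\<Sum>u\<in>words m n. \<Sum>i<m. f (u @ [i]))"
proof -
  have "words m (Suc n) = (\<lambda>(u, i). u @ [i]) ` (words m n \<times> {..<m})"
  proof (intro equalityI subsetI)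
    fix v
    assume "v \<in> words m (Suc n)"
    then show "v \<in> (\<lambda>(u, i). u @ [i]) ` (words m n \<times> {..<m})"
      by (cases v rule: rev_cases) (auto simp: words_def)
  qed (auto simp: words_def)
  moreover have "inj_on (\<lambda>(u, i). u @ [i]) (words m n \<times> {..<m})"
    by (auto simp: inj_on_def)
  ultimately have "(\<Sum>u\<in>words m (Suc n). f u) = (\<Sum>(u, i)\<in>words m n \<times> {..<m}. f (u @ [i]))"
    by (simp add: sum.reindex split_def)
  also have "\<dots> = (\<Sum>u\<in>words m n. \<Sum>i<m. f (u @ [i]))"
    by (simp add: sum.cartesian_product)
  finally show ?thesis .
qed

definition weight :: "(real \<Rightarrow> 'r) \<Rightarrow> real \<Rightarrow> nat list \<Rightarrow> (nat list \<Rightarrow> nat \<Rightarrow> ereal) \<Rightarrow> 'r :: zero" where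
  "weight g x u w = (if survives coord x u w then g (x + position coord u w) else 0)"

abbreviation labels :: "(nat list \<Rightarrow> nat \<Rightarrow> ereal) measure" where
  "labels \<equiv> \<Pi>\<^sub>M u\<in>UNIV. \<Pi>\<^sub>M i\<in>UNIV. borel"

lemma measurable_coord [measurable]: "(\<lambda>w. coord u w i) \<in> borel_measurable labels"
  unfolding coord_def
  by (rule measurable_compose[OF measurable_component_singleton[of u UNIV "\<lambda>_. \<Pi>\<^sub>M i\<in>UNIV. borel"]
        measurable_component_singleton[of i UNIV "\<lambda>_. borel"]]) auto

lemma measurable_position [measurable]: "position coord u \<in> borel_measurable labels"
proof (induction u rule: rev_induct)
  case (snoc i u)
  note [measurable] = snoc
  show ?case
    unfolding position_snoc[abs_def] by measurable
qed (simp add: position_def)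

lemma measurable_survives [measurable]: "Measurable.pred labels (survives coord x u)"
proof (induction u rule: rev_induct)
  case (snoc i u)
  note [measurable] = snoc
  show ?case
    unfolding survives_snoc[abs_def] by measurable
qed simp

lemma measurable_weight [measurable]:
  assumes [measurable]: "g \<in> borel_measurable borel"
  shows "weight g x u \<in> borel_measurable labels"
  unfolding weight_def by measurable

text \<open>The position of u reads only the displacements attached to proper prefixes of u, and
  these are shorter than v.\<close>

lemma position_upd: "length u \<le> length v \<Longrightarrow> position coord u (w(v := y)) = position coord u w"
  by (induction u rule: rev_induct) (auto simp: position_snoc coord_def)

lemma survives_upd: "length u \<le> length v \<Longrightarrow> survives coord x u (w(v := y)) = survives coord x u w"
  by (induction u rule: rev_induct) (auto simp: survives_snoc coord_def position_upd)

lemma weight_upd: "length u \<le> length v \<Longrightarrow> weight g x u (w(v := y)) = weight g x u w"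
  by (simp add: weight_def survives_upd position_upd)

lemma weight_snoc: "weight g x (u @ [i]) w = (if survives coord x u w then
    (if w u i \<noteq> \<infinity> \<and> 0 \<le> (x + position coord u w) + real_of_ereal (w u i)
     then g ((x + position coord u w) + real_of_ereal (w u i)) else 0) else 0)"
  by (simp add: weight_def survives_snoc position_snoc coord_def add.assoc)

text \<open>Among the labels at least as long as u, a child of u reads only u itself. This is the
  form required of \<open>Q\<close> in \<open>nn_integral_PiM_prod_le\<close>.\<close>

lemma weight_snoc_upd_other:
  "length u \<le> length v \<Longrightarrow> u \<noteq> v \<Longrightarrow> weight g x (u @ [i]) (w(v := y)) = weight g x (u @ [i]) w"
  by (auto simp: weight_snoc survives_upd position_upd)

context branching_step
begin

abbreviation trees :: "(nat list \<Rightarrow> nat \<Rightarrow> ereal) measure" where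
  "trees \<equiv> \<Pi>\<^sub>M u\<in>UNIV. N"

lemma sets_trees [measurable_cong]: "sets trees = sets labels"
  by (intro sets_PiM_cong refl sets_N)

lemma prob_space_trees: "prob_space trees"
  by (intro prob_space_PiM prob_N)

lemma exp_sum_weight_le:
  assumes [measurable]: "g \<in> borel_measurable borel"
    and step: "\<And>x. x \<ge> 0 \<Longrightarrow> (\<integral>\<^sup>+y. ennreal (exp (\<Sum>i<m. if y i \<noteq> \<infinity> \<and> 0 \<le> x + real_of_ereal (y i)
      then g (x + real_of_ereal (y i)) else 0)) \<partial>N) \<le> ennreal (exp (g x))"
    and x: "x \<ge> 0"
  shows "(\<integral>\<^sup>+w. ennreal (exp (\<Sum>u\<in>words m n. weight g x u w)) \<partial>trees) \<le> ennreal (exp (g x))"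
proof (induction n)
  case 0
  show ?case
    using x prob_space.emeasure_space_1[OF prob_space_trees] by (simp add: weight_def)
next
  case (Suc n)
  interpret N: prob_space N by (rule prob_N)
  let ?Q = "\<lambda>u w. ennreal (exp (\<Sum>i<m. weight g x (u @ [i]) w))"
  let ?G = "\<lambda>u w. ennreal (exp (weight g x u w))"
  have "(\<integral>\<^sup>+w. ennreal (exp (\<Sum>u\<in>words m (Suc n). weight g x u w)) \<partial>trees) =
      (\<integral>\<^sup>+w. 1 * (\<Prod>u\<in>words m n. ?Q u w) \<partial>trees)"
    by (simp add: sum_words_Suc ennreal_exp_sum[OF finite_words])
  also have "\<dots> \<le> (\<integral>\<^sup>+w. 1 * (\<Prod>u\<in>words m n. ?G u w) \<partial>trees)"
  proof (rule nn_integral_PiM_prod_le[OF prob_N finite_words])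
    fix w u
    assume "u \<in> words m n"
    show "(\<integral>\<^sup>+y. ?Q u (w(u := y)) \<partial>N) \<le> ?G u w"
    proof (cases "survives coord x u w")
      case True
      then have "(\<integral>\<^sup>+y. ?Q u (w(u := y)) \<partial>N) = (\<integral>\<^sup>+y. ennreal (exp (\<Sum>i<m.
          if y i \<noteq> \<infinity> \<and> 0 \<le> (x + position coord u w) + real_of_ereal (y i)
          then g ((x + position coord u w) + real_of_ereal (y i)) else 0)) \<partial>N)"
        by (simp add: weight_snoc survives_upd position_upd cong: if_cong)
      also have "\<dots> \<le> ennreal (exp (g (x + position coord u w)))"
        by (rule step) (rule survives_nonneg[OF True])
      finally show ?thesis
        using True by (simp add: weight_def)
    next
      \<comment> \<open>A killed or absent particle contributes weight 0, and so do its children: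
        both sides are 1.\<close>
      case False
      then have "weight g x (u @ [i]) (w(u := y)) = 0" for i y
        by (simp add: weight_snoc survives_upd)
      then show ?thesis
        using False by (simp add: weight_def N.emeasure_space_1)
    qed
  qed (auto simp: weight_upd weight_snoc_upd_other length_words)
  also have "\<dots> = (\<integral>\<^sup>+w. ennreal (exp (\<Sum>u\<in>words m n. weight g x u w)) \<partial>trees)"
    by (simp add: ennreal_exp_sum)
  finally show ?case
    using Suc by simp
qed

section \<open>The truncated martingale over finitely many labels\<close>

definition mart_weight :: "real \<Rightarrow> real" where
  "mart_weight x = renew_real x * exp (- x)"

lemma measurable_mart_weight [measurable]: "mart_weight \<in> borel_measurable borel"
  unfolding mart_weight_def by measurable

lemma mart_weight_nonneg: "0 \<le> mart_weight x"
  by (simp add: mart_weight_def renew_real_def)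

text \<open>
  Only labels with entries below \<open>m\<close> are summed, so that the sum is finite and real.
\<close>

definition finite_mart :: "real \<Rightarrow> nat \<Rightarrow> nat \<Rightarrow> (nat list \<Rightarrow> nat \<Rightarrow> ereal) \<Rightarrow> real" where
  "finite_mart x m n w = (\<Sum>u\<in>words m n. weight mart_weight x u w)"

lemma measurable_finite_mart [measurable]: "finite_mart x m n \<in> borel_measurable labels"
  unfolding finite_mart_def by measurable

lemma weight_mart_weight_nonneg: "0 \<le> weight mart_weight x u w"
  by (simp add: weight_def mart_weight_nonneg)

lemma finite_mart_nonneg: "0 \<le> finite_mart x m n w"
  unfolding finite_mart_def by (intro sum_nonneg weight_mart_weight_nonneg)

lemma finite_mart_mono: "m \<le> m' \<Longrightarrow> finite_mart x m n w \<le> finite_mart x m' n w"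
  unfolding finite_mart_def by (intro sum_mono2 finite_words weight_mart_weight_nonneg words_mono)

text \<open>Subtracting 1 before applying Markov's inequality makes the bound proportional to
  \<open>mart_weight x\<close>, because exp(g) - 1 <= g exp(g) and g is bounded on the
  half-line.\<close>

lemma finite_mart_tail:
  "\<exists>C>0. \<exists>c>0. \<forall>x\<ge>0. \<forall>y\<ge>1. \<forall>m n.
    emeasure trees {w \<in> space trees. y < finite_mart x m n w} \<le> ennreal (C * mart_weight x * exp (- c * y))"
proof -
  interpret T: prob_space trees by (rule prob_space_trees)
  obtain c g where c: "c > 0" and [measurable]: "g \<in> borel_measurable borel"
    and bounds: "\<And>x. x \<ge> 0 \<Longrightarrow> c * mart_weight x \<le> g x \<and> g x \<le> 2 * c * mart_weight x"
    and step: "\<And>x n. x \<ge> 0 \<Longrightarrow> (\<integral>\<^sup>+y. ennreal (exp (\<Sum>i<n. if y i \<noteq> \<infinity> \<and> 0 \<le> x + real_of_ereal (y i)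
      then g (x + real_of_ereal (y i)) else 0)) \<partial>N) \<le> ennreal (exp (g x))"
    using exp_supermartingale_step unfolding mart_weight_def by blast
  obtain K :: real where K: "K \<ge> 1" "\<And>x. x \<ge> 0 \<Longrightarrow> renew_real x \<le> K * (1 + x)"
    using renew_real_linear by blast
  have mart_weight_le: "mart_weight x \<le> K" if x: "x \<ge> 0" for x
  proof -
    have "mart_weight x \<le> K * (1 + x) * exp (- x)"
      unfolding mart_weight_def by (intro mult_right_mono K x) auto
    also have "\<dots> = K * ((1 + x) * exp (- x))"
      by simp
    also have "\<dots> \<le> K * 1"
      using K exp_ge_add_one_self[of x] by (intro mult_left_mono) (auto simp: exp_minus field_simps)
    finally show ?thesis
      by simp
  qed
  \<comment> \<open>The numerator comes from the bound on g exp(g). The denominator comes from exp(c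
    y) - 1 >= (1 - exp(- c)) exp(c y), where y >= 1 is used.\<close>
  define C where "C = 2 * c * exp (2 * c * K) / (1 - exp (- c))"
  have C: "C > 0"
    using c by (simp add: C_def)
  have "emeasure trees {w \<in> space trees. y < finite_mart x m n w} \<le> ennreal (C * mart_weight x * exp (- c * y))"
    if x: "x \<ge> 0" and y: "y \<ge> 1" for x y :: real and m n
  proof -
    define p where "p = measure trees {w \<in> space trees. y < finite_mart x m n w}"
    have p: "p \<ge> 0" "emeasure trees {w \<in> space trees. y < finite_mart x m n w} = ennreal p"
      by (simp_all add: p_def T.emeasure_eq_measure)
    have cy: "exp (c * y) - 1 > 0"
      using c y by simp
    \<comment> \<open>Markov's inequality with 1 added to both sides, so that no nonnegative
      integrals are subtracted.\<close>
    have "ennreal ((exp (c * y) - 1) * p + 1)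
        = (\<integral>\<^sup>+w. ennreal (exp (c * y) - 1) * indicator {w \<in> space trees. y < finite_mart x m n w} w + 1 \<partial>trees)"
      using cy p by (simp add: nn_integral_add nn_integral_cmult_indicator T.emeasure_space_1 ennreal_mult)
    also have "\<dots> \<le> (\<integral>\<^sup>+w. ennreal (exp (\<Sum>u\<in>words m n. weight g x u w)) \<partial>trees)"
    proof (rule nn_integral_mono)
      fix w
      have "c * finite_mart x m n w \<le> (\<Sum>u\<in>words m n. weight g x u w)"
        unfolding finite_mart_def sum_distrib_left
        by (intro sum_mono) (auto simp: weight_def dest!: survives_nonneg bounds)
      then have le: "exp (c * finite_mart x m n w) \<le> exp (\<Sum>u\<in>words m n. weight g x u w)"
        by simp
      have "ennreal (exp (c * y) - 1) * indicator {w \<in> space trees. y < finite_mart x m n w} w + 1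
          \<le> ennreal (exp (c * finite_mart x m n w))"
      proof (cases "y < finite_mart x m n w")
        case True
        have "ennreal (exp (c * y) - 1) * indicator {w \<in> space trees. y < finite_mart x m n w} w + 1
            \<le> ennreal (exp (c * y) - 1) + ennreal 1"
          by (auto split: split_indicator)
        also have "\<dots> = ennreal (exp (c * y))"
          using cy by (subst ennreal_plus[symmetric]) auto
        also have "\<dots> \<le> ennreal (exp (c * finite_mart x m n w))"
          using True c by (intro ennreal_leI) simp
        finally show ?thesis .
      next
        case False
        have "0 \<le> c * finite_mart x m n w"
          using c finite_mart_nonneg by simp
        then show ?thesis
          using False by (simp add: ennreal_1[symmetric] del: ennreal_1)
      qed
      also have "\<dots> \<le> ennreal (exp (\<Sum>u\<in>words m n. weight g x u w))"
        by (rule ennreal_leI[OF le])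
      finally show "ennreal (exp (c * y) - 1) * indicator {w \<in> space trees. y < finite_mart x m n w} w + 1
          \<le> ennreal (exp (\<Sum>u\<in>words m n. weight g x u w))" .
    qed
    also have "\<dots> \<le> ennreal (exp (g x))"
      by (intro exp_sum_weight_le step x) auto
    finally have main: "(exp (c * y) - 1) * p + 1 \<le> exp (g x)"
      by simp
    have g: "0 \<le> g x" "g x \<le> 2 * c * mart_weight x"
      using bounds[OF x] mult_nonneg_nonneg[OF less_imp_le[OF c] mart_weight_nonneg[of x]] by linarith+
    have "exp (g x) - 1 \<le> g x * exp (g x)"
      using exp_ge_add_one_self[of "- g x"] by (simp add: exp_minus field_simps)
    also have "\<dots> \<le> (2 * c * mart_weight x) * exp (2 * c * K)"
    proof (rule mult_mono)
      have "2 * c * mart_weight x \<le> 2 * c * K"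
        using c mart_weight_le[OF x] by (intro mult_left_mono) auto
      then show "exp (g x) \<le> exp (2 * c * K)"
        using g by simp
    qed (use g c mart_weight_nonneg in auto)
    finally have 1: "(exp (c * y) - 1) * p \<le> 2 * c * mart_weight x * exp (2 * c * K)"
      using main by simp
    have "exp (- c * y) \<le> exp (- c)"
      using c y by simp
    then have "(1 - exp (- c)) * p \<le> (1 - exp (- c * y)) * p"
      using p by (intro mult_right_mono) auto
    also have "\<dots> = exp (- c * y) * ((exp (c * y) - 1) * p)"
      by (simp add: exp_minus field_simps)
    also have "\<dots> \<le> exp (- c * y) * (2 * c * mart_weight x * exp (2 * c * K))"
      using 1 by (rule mult_left_mono) simp
    finally have "p \<le> C * mart_weight x * exp (- c * y)"
      using c by (simp add: C_def field_simps)
    then show ?thesis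
      unfolding p(2) by (rule ennreal_leI)
  qed
  then show ?thesis
    using C c by blast
qed

section \<open>All labels: the monotone limit and its convergence in n\<close>

definition tree_mart :: "real \<Rightarrow> nat \<Rightarrow> (nat list \<Rightarrow> nat \<Rightarrow> ereal) \<Rightarrow> ennreal" where
  "tree_mart x n w = (SUP m. ennreal (finite_mart x m n w))"

lemma measurable_tree_mart [measurable]: "tree_mart x n \<in> borel_measurable labels"
  unfolding tree_mart_def by measurable

text \<open>Since the inequality is strict, the supremum exceeds y exactly when some member does.
  The events increase with m and the bound \<open>B\<close> is uniform.\<close>

lemma tree_mart_tail:
  assumes "\<And>m. emeasure trees {w \<in> space trees. y < finite_mart x m n w} \<le> B"
  shows "emeasure trees {w \<in> space trees. ennreal y < tree_mart x n w} \<le> B"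
proof -
  let ?E = "\<lambda>m. {w \<in> space trees. ennreal y < ennreal (finite_mart x m n w)}"
  have E: "range ?E \<subseteq> sets trees"
    by auto
  have "{w \<in> space trees. ennreal y < tree_mart x n w} = (\<Union>m. ?E m)"
    by (auto simp: tree_mart_def less_SUP_iff)
  also have "emeasure trees \<dots> = (SUP m. emeasure trees (?E m))"
    using E by (intro SUP_emeasure_incseq[symmetric])
      (auto intro!: monoI intro: less_le_trans ennreal_leI finite_mart_mono)
  also have "\<dots> \<le> B"
  proof (rule SUP_least)
    fix m
    have "emeasure trees (?E m) \<le> emeasure trees {w \<in> space trees. y < finite_mart x m n w}"
    proof (intro emeasure_mono subsetI CollectI conjI)
      show "y < finite_mart x m n w" if "w \<in> ?E m" for w
        using that ennreal_leI[of "finite_mart x m n w" y] by (auto simp: not_less[symmetric])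
    qed auto
    then show "emeasure trees (?E m) \<le> B"
      using assms[of m] by simp
  qed
  finally show ?thesis .
qed

lemma weight_mart_weight_step:
  "(\<integral>\<^sup>+y. (\<Sum>i<m. ennreal (weight mart_weight x (u @ [i]) (w(u := y)))) \<partial>N) \<le> ennreal (weight mart_weight x u w)"
proof (cases "survives coord x u w")
  case True
  define z where "z = x + position coord u w"
  have z: "z \<ge> 0"
    using survives_nonneg[OF True] by (simp add: z_def)
  let ?f = "\<lambda>v. ennreal (exp (- z)) * (renew (z + v) * indicator {0..} (z + v))"
  have f: "ennreal (mart_weight (z + v)) = ?f v * ennreal (exp (- v))" if "0 \<le> z + v" for v
    using that renew_real_ge_1[OF that]
    by (simp add: mart_weight_def renew_eq_renew_real ennreal_mult[symmetric] mult_exp_exp mult.commute mult.left_commute)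
  have "(\<integral>\<^sup>+y. (\<Sum>i<m. ennreal (weight mart_weight x (u @ [i]) (w(u := y)))) \<partial>N)
      \<le> (\<integral>\<^sup>+y. point_sum (\<lambda>v. ?f v * ennreal (exp (- v))) y \<partial>N)"
  proof (rule nn_integral_mono)
    fix y
    have "(\<Sum>i<m. ennreal (weight mart_weight x (u @ [i]) (w(u := y)))) =
        (\<Sum>i<m. if y i = \<infinity> then 0 else ?f (real_of_ereal (y i)) * ennreal (exp (- real_of_ereal (y i))))"
      using True f by (intro sum.cong) (auto simp: weight_snoc survives_upd position_upd z_def[symmetric])
    also have "\<dots> \<le> point_sum (\<lambda>v. ?f v * ennreal (exp (- v))) y"
      by (rule partial_sum_le_point_sum)
    finally show "(\<Sum>i<m. ennreal (weight mart_weight x (u @ [i]) (w(u := y))))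
        \<le> point_sum (\<lambda>v. ?f v * ennreal (exp (- v))) y" .
  qed
  also have "\<dots> = (\<integral>\<^sup>+v. ?f v \<partial>L)"
    by (rule many_to_one) measurable
  also have "\<dots> = ennreal (exp (- z)) * (\<integral>\<^sup>+v. renew (z + v) * indicator {0..} (z + v) \<partial>L)"
    by (rule nn_integral_cmult) measurable
  also have "\<dots> \<le> ennreal (exp (- z)) * renew z"
    by (intro mult_left_mono renew_superharmonic z) auto
  also have "\<dots> = ennreal (weight mart_weight x u w)"
    using True z renew_real_ge_1[OF z]
    by (simp add: weight_def z_def[symmetric] mart_weight_def renew_eq_renew_real ennreal_mult[symmetric] mult.commute)
  finally show ?thesis .
next
  case False
  then show ?thesis
    by (simp add: weight_snoc survives_upd)
qed

lemma finite_mart_upd: "n \<le> length v \<Longrightarrow> finite_mart x m n (w(v := y)) = finite_mart x m n w"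
  unfolding finite_mart_def by (intro sum.cong) (auto simp: weight_upd length_words)

lemma tree_mart_upd: "n \<le> length v \<Longrightarrow> tree_mart x n (w(v := y)) = tree_mart x n w"
  by (simp add: tree_mart_def finite_mart_upd)

text \<open>Invariance of \<open>A\<close> under changes at single labels of length n plays the part
  of measurability with respect to the first n generations. It suffices because the children of u
  are averaged by resampling the label u alone.\<close>

lemma tree_mart_super:
  assumes A [measurable]: "A \<in> sets trees"
    and upd: "\<And>w v y. length v = n \<Longrightarrow> w(v := y) \<in> A \<longleftrightarrow> w \<in> A"
  shows "(\<integral>\<^sup>+w. tree_mart x (Suc n) w * indicator A w \<partial>trees) \<le> (\<integral>\<^sup>+w. tree_mart x n w * indicator A w \<partial>trees)"
proof -
  have le: "(\<integral>\<^sup>+w. ennreal (finite_mart x m (Suc n) w) * indicator A w \<partial>trees)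
      \<le> (\<integral>\<^sup>+w. tree_mart x n w * indicator A w \<partial>trees)" for m
  proof -
    let ?f = "\<lambda>u w. (\<Sum>i<m. ennreal (weight mart_weight x (u @ [i]) w))"
    have [measurable]: "weight mart_weight x u \<in> borel_measurable trees" for u
      by measurable
    have one: "(\<integral>\<^sup>+w. ?f u w * indicator A w \<partial>trees) \<le> (\<integral>\<^sup>+w. ennreal (weight mart_weight x u w) * indicator A w \<partial>trees)"
      if u: "length u = n" for u
    proof -
      have "(\<integral>\<^sup>+w. ?f u w * indicator A w \<partial>trees)
          = (\<integral>\<^sup>+w. (\<integral>\<^sup>+y. ?f u (w(u := y)) * indicator A w \<partial>N) \<partial>trees)"
        by (subst nn_integral_PiM_resample[OF prob_N, where u = u]) (simp_all add: indicator_def upd[OF u])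
      also have "\<dots> = (\<integral>\<^sup>+w. (\<integral>\<^sup>+y. ?f u (w(u := y)) \<partial>N) * indicator A w \<partial>trees)"
        by (intro nn_integral_cong nn_integral_multc) measurable
      also have "\<dots> \<le> (\<integral>\<^sup>+w. ennreal (weight mart_weight x u w) * indicator A w \<partial>trees)"
        by (intro nn_integral_mono mult_right_mono weight_mart_weight_step) auto
      finally show ?thesis .
    qed
    have "(\<integral>\<^sup>+w. ennreal (finite_mart x m (Suc n) w) * indicator A w \<partial>trees)
        = (\<integral>\<^sup>+w. (\<Sum>u\<in>words m n. ?f u w * indicator A w) \<partial>trees)"
      by (simp add: finite_mart_def sum_words_Suc sum_distrib_right weight_mart_weight_nonneg sum_nonneg flip: sum_ennreal)
    also have "\<dots> = (\<Sum>u\<in>words m n. \<integral>\<^sup>+w. ?f u w * indicator A w \<partial>trees)"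
      by (rule nn_integral_sum) measurable
    also have "\<dots> \<le> (\<Sum>u\<in>words m n. \<integral>\<^sup>+w. ennreal (weight mart_weight x u w) * indicator A w \<partial>trees)"
      by (intro sum_mono one length_words)
    also have "\<dots> = (\<integral>\<^sup>+w. (\<Sum>u\<in>words m n. ennreal (weight mart_weight x u w) * indicator A w) \<partial>trees)"
      by (rule nn_integral_sum[symmetric]) measurable
    also have "\<dots> = (\<integral>\<^sup>+w. ennreal (finite_mart x m n w) * indicator A w \<partial>trees)"
      by (simp add: finite_mart_def sum_distrib_right weight_mart_weight_nonneg flip: sum_ennreal)
    also have "\<dots> \<le> (\<integral>\<^sup>+w. tree_mart x n w * indicator A w \<partial>trees)"
      unfolding tree_mart_def by (intro nn_integral_mono mult_right_mono SUP_upper) auto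
    finally show ?thesis .
  qed
  have "(\<integral>\<^sup>+w. tree_mart x (Suc n) w * indicator A w \<partial>trees)
      = (\<integral>\<^sup>+w. (SUP m. ennreal (finite_mart x m (Suc n) w) * indicator A w) \<partial>trees)"
    unfolding tree_mart_def by (intro nn_integral_cong SUP_mult_right_ennreal)
  also have "\<dots> = (SUP m. \<integral>\<^sup>+w. ennreal (finite_mart x m (Suc n) w) * indicator A w \<partial>trees)"
    by (intro nn_integral_monotone_convergence_SUP monoI le_funI mult_right_mono ennreal_leI finite_mart_mono) measurable
  also have "\<dots> \<le> (\<integral>\<^sup>+w. tree_mart x n w * indicator A w \<partial>trees)"
    by (intro SUP_least le)
  finally show ?thesis .
qed

lemma nonneg_supermartingale_tree_mart: "nonneg_supermartingale trees (tree_mart x)"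
proof (intro nonneg_supermartingale.intro nonneg_supermartingale_axioms.intro prob_space_trees)
  fix n A
  assume A: "A \<in> sets trees"
    and det: "\<And>w w'. w \<in> A \<Longrightarrow> w' \<in> space trees \<Longrightarrow> (\<And>k. k \<le> n \<Longrightarrow> tree_mart x k w = tree_mart x k w') \<Longrightarrow> w' \<in> A"
  have space: "space trees = UNIV"
    using sets_eq_imp_space_eq[OF sets_trees] by (simp add: space_PiM)
  show "(\<integral>\<^sup>+w. tree_mart x (Suc n) w * indicator A w \<partial>trees) \<le> (\<integral>\<^sup>+w. tree_mart x n w * indicator A w \<partial>trees)"
  proof (rule tree_mart_super[OF A])
    fix w :: "nat list \<Rightarrow> nat \<Rightarrow> ereal" and v :: "nat list" and y
    assume v: "length v = n"
    \<comment> \<open>A change at a label of length n is seen only by later generations, so an event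
      determined by the first values of the process is invariant.\<close>
    then have "tree_mart x k (w(v := y)) = tree_mart x k w" if "k \<le> n" for k
      using that by (intro tree_mart_upd) simp
    then show "w(v := y) \<in> A \<longleftrightarrow> w \<in> A"
      using det[of w "w(v := y)"] det[of "w(v := y)" w] by (auto simp: space)
  qed
qed measurable

text \<open>A limit above t forces all late members above t, and the events \<open>?E n\<close>
  increase. The divergence points, where \<open>lim\<close> is unspecified, go into a null set;
  hence a measurable superset takes the place of the event.\<close>

lemma tree_mart_lim_tail:
  assumes "\<And>n. emeasure trees {w \<in> space trees. t < tree_mart x n w} \<le> B"
  shows "\<exists>E\<in>sets trees. {w \<in> space trees. t < lim (\<lambda>n. tree_mart x n w)} \<subseteq> E \<and> emeasure trees E \<le> B"
proof -
  interpret D: nonneg_supermartingale trees "tree_mart x"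
    by (rule nonneg_supermartingale_tree_mart)
  let ?E = "\<lambda>n. {w \<in> space trees. \<forall>k\<ge>n. t < tree_mart x k w}"
  have E: "range ?E \<subseteq> sets trees"
    by auto
  obtain Z where Z: "Z \<in> null_sets trees" "{w \<in> space trees. \<not> (\<exists>s. (\<lambda>n. tree_mart x n w) \<longlonglongrightarrow> s)} \<subseteq> Z"
    using D.AE_convergent by (auto simp: eventually_ae_filter)
  have subset: "{w \<in> space trees. t < lim (\<lambda>n. tree_mart x n w)} \<subseteq> (\<Union>n. ?E n) \<union> Z"
  proof
    fix w
    assume w: "w \<in> {w \<in> space trees. t < lim (\<lambda>n. tree_mart x n w)}"
    show "w \<in> (\<Union>n. ?E n) \<union> Z"
    proof (cases "\<exists>s. (\<lambda>n. tree_mart x n w) \<longlonglongrightarrow> s")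
      case True
      then obtain s where s: "(\<lambda>n. tree_mart x n w) \<longlonglongrightarrow> s"
        by blast
      then have "t < s"
        using w limI[OF s] by simp
      then have "\<exists>n. \<forall>k\<ge>n. t < tree_mart x k w"
        using order_tendstoD(1)[OF s] by (simp add: eventually_sequentially)
      then show ?thesis
        using w by auto
    next
      case False
      then show ?thesis
        using w Z by auto
    qed
  qed
  have "emeasure trees ((\<Union>n. ?E n) \<union> Z) = emeasure trees (\<Union>n. ?E n)"
    using Z E by (intro emeasure_Un_null_set) auto
  also have "\<dots> = (SUP n. emeasure trees (?E n))"
    using E by (intro SUP_emeasure_incseq[symmetric]) (auto intro!: monoI)
  also have "\<dots> \<le> B"
  proof (rule SUP_least)
    fix n
    have "emeasure trees (?E n) \<le> emeasure trees {w \<in> space trees. t < tree_mart x n w}"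
      by (intro emeasure_mono) auto
    then show "emeasure trees (?E n) \<le> B"
      using assms[of n] by simp
  qed
  finally have "emeasure trees ((\<Union>n. ?E n) \<union> Z) \<le> B" .
  moreover have "(\<Union>n. ?E n) \<union> Z \<in> sets trees"
    using Z E by (intro sets.Un sets.countable_UN) auto
  ultimately show ?thesis
    using subset by blast
qed

end

section \<open>The associated walk and the tail estimate\<close>

lemma nn_integral_point_sum:
  fixes f :: "real \<Rightarrow> ennreal"
  shows "(\<integral>\<^sup>+i. (if y i = \<infinity> then 0 else f (real_of_ereal (y i))) \<partial>count_space UNIV) = point_sum f y"
  by (simp add: point_sum_def nn_integral_count_space_nat)

lemma (in real_distribution) Re_char: "Re (char M t) = expectation (\<lambda>x. cos (t * x))"
  and Im_char: "Im (char M t) = expectation (\<lambda>x. sin (t * x))"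
proof -
  have int: "integrable M (\<lambda>x. exp (\<i> * complex_of_real (t * x)))"
    by (rule integrable_iexp) auto
  show "Re (char M t) = expectation (\<lambda>x. cos (t * x))"
    unfolding char_def using integral_Re[OF int] by (simp add: Re_exp)
  show "Im (char M t) = expectation (\<lambda>x. sin (t * x))"
    unfolding char_def using integral_Im[OF int] by (simp add: Im_exp)
qed

text \<open>A law on the line is determined by its integrals of \<open>1 + cos\<close> and \<open>1 + sin\<close>, both nonnegative.\<close>

lemma real_distribution_eqI:
  assumes "real_distribution L" "real_distribution L'"
    and eq: "\<And>f. continuous_on UNIV f \<Longrightarrow> (\<And>x. 0 \<le> f x \<and> f x \<le> 2) \<Longrightarrow>
      (\<integral>x. f x \<partial>L) = (\<integral>x. (f x :: real) \<partial>L')"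
  shows "L = L'"
proof (rule Levy_uniqueness)
  interpret L: real_distribution L by fact
  interpret L': real_distribution L' by fact
  have prob [simp]: "measure L UNIV = 1" "measure L' UNIV = 1"
    using L.prob_space L'.prob_space by simp_all
  show "char L = char L'"
  proof
    fix t
    have cos_int: "integrable L (\<lambda>x. cos (t * x))" "integrable L' (\<lambda>x. cos (t * x))"
      by (auto intro!: L.integrable_const_bound[of _ 1] L'.integrable_const_bound[of _ 1])
    have sin_int: "integrable L (\<lambda>x. sin (t * x))" "integrable L' (\<lambda>x. sin (t * x))"
      by (auto intro!: L.integrable_const_bound[of _ 1] L'.integrable_const_bound[of _ 1])
    have "(\<integral>x. 1 + cos (t * x) \<partial>L) = (\<integral>x. 1 + cos (t * x) \<partial>L')"
      by (intro eq continuous_intros) (use cos_ge_minus_one cos_le_one in \<open>smt (verit)\<close>)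
    then have c: "(\<integral>x. cos (t * x) \<partial>L) = (\<integral>x. cos (t * x) \<partial>L')"
      using cos_int by simp
    have "(\<integral>x. 1 + sin (t * x) \<partial>L) = (\<integral>x. 1 + sin (t * x) \<partial>L')"
      by (intro eq continuous_intros) (use sin_ge_minus_one sin_le_one in \<open>smt (verit)\<close>)
    then have s: "(\<integral>x. sin (t * x) \<partial>L) = (\<integral>x. sin (t * x) \<partial>L')"
      using sin_int by simp
    show "char L t = char L' t"
      using c s by (simp add: complex_eq_iff L.Re_char L.Im_char L'.Re_char L'.Im_char)
  qed
qed (use assms in auto)

text \<open>The mean measure of the point process, weighted by exp(- v). Its total mass is 1 when
  the log-Laplace transform vanishes at 1.\<close>

definition tilted :: "(nat \<Rightarrow> ereal) measure \<Rightarrow> real measure" where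
  "tilted N = distr (density (N \<Otimes>\<^sub>M count_space UNIV)
     (\<lambda>(y, i). if y i = \<infinity> then 0 else ennreal (exp (- real_of_ereal (y i))))) borel
     (\<lambda>(y, i). real_of_ereal (y i))"

lemma nn_integral_tilted:
  assumes sets_N [measurable_cong]: "sets N = sets (\<Pi>\<^sub>M i\<in>UNIV. borel)"
    and [measurable]: "f \<in> borel_measurable borel"
  shows "(\<integral>\<^sup>+z. f z \<partial>tilted N) = (\<integral>\<^sup>+y. point_sum (\<lambda>v. f v * ennreal (exp (- v))) y \<partial>N)"
proof -
  interpret C: sigma_finite_measure "count_space (UNIV :: nat set)"
    by (rule sigma_finite_measure_count_space)
  have [measurable]: "(\<lambda>p. (fst p :: nat \<Rightarrow> ereal) (snd p)) \<in> borel_measurable (N \<Otimes>\<^sub>M count_space UNIV)"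
    by (rule measurable_compose_countable[where f = "\<lambda>i p. fst p i" and g = snd]) measurable
  have "(\<integral>\<^sup>+z. f z \<partial>tilted N) = (\<integral>\<^sup>+p. (if fst p (snd p) = \<infinity> then 0
      else ennreal (exp (- real_of_ereal (fst p (snd p))))) * f (real_of_ereal (fst p (snd p)))
      \<partial>(N \<Otimes>\<^sub>M count_space UNIV))"
    unfolding tilted_def split_def by (subst nn_integral_distr, measurable, subst nn_integral_density) measurable
  also have "\<dots> = (\<integral>\<^sup>+y. (\<integral>\<^sup>+i. (if y i = \<infinity> then 0
      else ennreal (exp (- real_of_ereal (y i)))) * f (real_of_ereal (y i)) \<partial>count_space UNIV) \<partial>N)"
    by (subst C.nn_integral_fst[symmetric]) (simp_all cong: if_cong)
  also have "\<dots> = (\<integral>\<^sup>+y. point_sum (\<lambda>v. f v * ennreal (exp (- v))) y \<partial>N)"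
    unfolding nn_integral_point_sum[symmetric] by (intro nn_integral_cong) (simp add: mult.commute)
  finally show ?thesis .
qed

lemma generation_1: "generation \<xi> 1 \<omega> = (\<lambda>i. [i]) ` {i. \<xi> [] \<omega> i \<noteq> \<infinity>}"
proof (intro equalityI subsetI)
  fix u
  assume "u \<in> generation \<xi> 1 \<omega>"
  then show "u \<in> (\<lambda>i. [i]) ` {i. \<xi> [] \<omega> i \<noteq> \<infinity>}"
    by (cases u) (auto simp: generation_def tree_def)
qed (auto simp: generation_def tree_def)

lemma nn_integral_generation_1:
  "(\<integral>\<^sup>+u. f (position \<xi> u \<omega>) \<partial>count_space (generation \<xi> 1 \<omega>)) = point_sum f (\<xi> [] \<omega>)"
proof -
  have "(\<integral>\<^sup>+u. f (position \<xi> u \<omega>) \<partial>count_space (generation \<xi> 1 \<omega>)) =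
      (\<integral>\<^sup>+i. f (position \<xi> [i] \<omega>) \<partial>count_space {i. \<xi> [] \<omega> i \<noteq> \<infinity>})"
    unfolding generation_1
    by (rule nn_integral_bij_count_space[symmetric]) (auto intro!: inj_on_imp_bij_betw inj_onI)
  also have "\<dots> = (\<integral>\<^sup>+i. (if \<xi> [] \<omega> i = \<infinity> then 0 else f (real_of_ereal (\<xi> [] \<omega> i))) \<partial>count_space UNIV)"
    by (subst nn_integral_count_space_indicator)
      (auto intro!: nn_integral_cong simp: position_def split: split_indicator)
  also have "\<dots> = point_sum f (\<xi> [] \<omega>)"
    by (rule nn_integral_point_sum)
  finally show ?thesis .
qed

lemma log_laplace_eq:
  "log_laplace M \<xi> \<theta> = ln_ennreal (\<integral>\<^sup>+\<omega>. point_sum (\<lambda>v. ennreal (exp (- \<theta> * v))) (\<xi> [] \<omega>) \<partial>M)"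
  unfolding log_laplace_def nn_integral_generation_1[where f = "\<lambda>v. ennreal (exp (- \<theta> * v))"] ..

lemma first_generation_sum_eq:
  "first_generation_sum \<xi> \<omega> = point_sum (\<lambda>v. ennreal ((1 + max v 0) * exp (- v))) (\<xi> [] \<omega>)"
  unfolding first_generation_sum_def
    nn_integral_generation_1[where f = "\<lambda>v. ennreal ((1 + max v 0) * exp (- v))"] ..

lemma ln_ennreal_eq_0: "m = 1" if "ln_ennreal m = 0"
proof (cases m rule: ennreal_cases)
  case (real b)
  then have "b > 0" "ln b = 0"
    using that by (auto simp: ln_ennreal_def zero_ereal_def split: if_splits)
  then show ?thesis
    using real by simp
qed (use that in \<open>simp add: ln_ennreal_def\<close>)

text \<open>\<open>associated_walk\<close> speaks of bounded continuous functions and Bochner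
  integrals. This identifies the law of \<open>S 1\<close> with the tilted measure, and the identity
  then extends to all nonnegative measurable f.\<close>

lemma many_to_one_of_associated_walk:
  assumes brw: "branching_random_walk M \<xi>" and aw: "associated_walk M \<xi> P S"
    and laplace: "log_laplace M \<xi> 1 = 0" and [measurable]: "f \<in> borel_measurable borel"
  shows "(\<integral>\<^sup>+\<omega>. point_sum (\<lambda>v. f v * ennreal (exp (- v))) (\<xi> [] \<omega>) \<partial>M) = (\<integral>\<^sup>+z. f z \<partial>distr P borel (S 1))"
    and "S 1 \<in> borel_measurable P"
proof -
  interpret M: prob_space M
    using brw by (simp add: branching_random_walk_def)
  interpret P: prob_space P
    using aw by (simp add: associated_walk_def)
  let ?B = "\<Pi>\<^sub>M i\<in>(UNIV :: nat set). (borel :: ereal measure)"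
  have [measurable]: "\<xi> [] \<in> M \<rightarrow>\<^sub>M ?B"
    using brw by (auto simp: branching_random_walk_def M.indep_vars_def)
  have "(\<lambda>\<omega>. S (Suc 0) \<omega> - S 0 \<omega>) \<in> borel_measurable P"
    using aw by (auto simp: associated_walk_def P.indep_vars_def)
  moreover have "S 1 \<omega> = S (Suc 0) \<omega> - S 0 \<omega>" if "\<omega> \<in> space P" for \<omega>
    using aw that by (simp add: associated_walk_def)
  ultimately show S1 [measurable]: "S 1 \<in> borel_measurable P"
    by (subst measurable_cong) auto
  let ?N = "distr M ?B (\<xi> [])"
  have tilt: "(\<integral>\<^sup>+z. h z \<partial>tilted ?N) = (\<integral>\<^sup>+\<omega>. point_sum (\<lambda>v. h v * ennreal (exp (- v))) (\<xi> [] \<omega>) \<partial>M)"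
    if [measurable]: "h \<in> borel_measurable borel" for h
    by (simp add: nn_integral_tilted nn_integral_distr)
  have "(\<integral>\<^sup>+\<omega>. point_sum (\<lambda>v. ennreal (exp (- v))) (\<xi> [] \<omega>) \<partial>M) = 1"
    using ln_ennreal_eq_0[OF laplace[unfolded log_laplace_eq]] by simp
  then have "emeasure (tilted ?N) (space (tilted ?N)) = 1"
    using tilt[of "\<lambda>_. 1"] by (simp add: nn_integral_const)
  then interpret T: prob_space "tilted ?N"
    by (rule prob_spaceI)
  have sets_T: "sets (tilted ?N) = sets borel"
    by (simp add: tilted_def)
  have "distr P borel (S 1) = tilted ?N"
  proof (rule real_distribution_eqI)
    show "real_distribution (distr P borel (S 1))"
      by (rule P.real_distribution_distr) measurable
    show "real_distribution (tilted ?N)"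
      by (intro real_distribution.intro real_distribution_axioms.intro T.prob_space_axioms sets_T)
    fix h :: "real \<Rightarrow> real"
    assume cont: "continuous_on UNIV h" and h: "\<And>x. 0 \<le> h x \<and> h x \<le> 2"
    have [measurable]: "h \<in> borel_measurable borel"
      using cont by (rule borel_measurable_continuous_onI)
    have bdd: "bounded (range h)"
      by (rule boundedI[of _ 2]) (use h in auto)
    define G where "G \<omega> = point_sum (\<lambda>v. ennreal (h v) * ennreal (exp (- v))) (\<xi> [] \<omega>)" for \<omega>
    have [measurable]: "G \<in> borel_measurable M"
      unfolding G_def by measurable
    \<comment> \<open>If the sum over the children diverges, both sides are 0, by the default values
      of the Bochner integral and of \<open>enn2real\<close>; \<open>fin\<close> below shows that
      this happens only on a null set.\<close>
    have inner: "(\<integral>u. h (position \<xi> u \<omega>) * exp (- position \<xi> u \<omega>) \<partial>count_space (generation \<xi> 1 \<omega>)) = enn2real (G \<omega>)" for \<omega>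
    proof -
      have "(\<integral>u. h (position \<xi> u \<omega>) * exp (- position \<xi> u \<omega>) \<partial>count_space (generation \<xi> 1 \<omega>)) =
          enn2real (\<integral>\<^sup>+u. ennreal (h (position \<xi> u \<omega>) * exp (- position \<xi> u \<omega>)) \<partial>count_space (generation \<xi> 1 \<omega>))"
        using h by (intro integral_eq_nn_integral) auto
      also have "(\<integral>\<^sup>+u. ennreal (h (position \<xi> u \<omega>) * exp (- position \<xi> u \<omega>)) \<partial>count_space (generation \<xi> 1 \<omega>)) = G \<omega>"
        unfolding G_def nn_integral_generation_1[symmetric] using h by (simp add: ennreal_mult)
      finally show ?thesis .
    qed
    have G_int: "(\<integral>\<^sup>+\<omega>. G \<omega> \<partial>M) = (\<integral>\<^sup>+z. ennreal (h z) \<partial>tilted ?N)"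
      unfolding G_def by (rule tilt[symmetric]) measurable
    also have "\<dots> \<le> (\<integral>\<^sup>+z. 2 \<partial>tilted ?N)"
      using h by (intro nn_integral_mono) (metis ennreal_leI ennreal_numeral zero_le_numeral)
    also have "\<dots> = 2"
      by (simp add: T.emeasure_space_1)
    finally have "(\<integral>\<^sup>+\<omega>. G \<omega> \<partial>M) \<noteq> \<infinity>"
      by (auto simp: top_unique)
    then have fin: "AE \<omega> in M. G \<omega> \<noteq> \<infinity>"
      by (intro nn_integral_PInf_AE) auto
    have "(\<integral>x. h x \<partial>distr P borel (S 1)) = (\<integral>\<omega>. h (S 1 \<omega>) \<partial>P)"
      by (rule integral_distr) measurable
    also have "\<dots> = (\<integral>\<omega>. (\<integral>u. h (position \<xi> u \<omega>) * exp (- position \<xi> u \<omega>)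
        \<partial>count_space (generation \<xi> 1 \<omega>)) \<partial>M)"
      using aw cont bdd unfolding associated_walk_def by blast
    also have "\<dots> = (\<integral>\<omega>. enn2real (G \<omega>) \<partial>M)"
      unfolding inner ..
    also have "\<dots> = enn2real (\<integral>\<^sup>+\<omega>. ennreal (enn2real (G \<omega>)) \<partial>M)"
      by (rule integral_eq_nn_integral) auto
    also have "(\<integral>\<^sup>+\<omega>. ennreal (enn2real (G \<omega>)) \<partial>M) = (\<integral>\<^sup>+\<omega>. G \<omega> \<partial>M)"
      using fin by (intro nn_integral_cong_AE) (auto simp: less_top)
    also have "enn2real \<dots> = (\<integral>z. h z \<partial>tilted ?N)"
      unfolding G_int by (rule integral_eq_nn_integral[symmetric]) (use h sets_T in \<open>auto cong: measurable_cong_sets\<close>)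
    finally show "(\<integral>x. h x \<partial>distr P borel (S 1)) = (\<integral>x. h x \<partial>tilted ?N)" .
  qed
  then show "(\<integral>\<^sup>+\<omega>. point_sum (\<lambda>v. f v * ennreal (exp (- v))) (\<xi> [] \<omega>) \<partial>M) = (\<integral>\<^sup>+z. f z \<partial>distr P borel (S 1))"
    by (simp add: tilt)
qed

lemma ln_ennreal_finite:
  assumes "\<bar>ln_ennreal m\<bar> \<noteq> \<infinity>"
  shows "m = ennreal (exp (real_of_ereal (ln_ennreal m)))"
  using assms by (cases m rule: ennreal_cases) (auto simp: ln_ennreal_def split: if_splits)

text \<open>
  Since \<open>E e\<^bsup>sz\<^esup> \<ge> 1 + s E z\<close>, with equality at \<open>s = 0\<close>, the derivative there is the mean; no
  differentiation under the integral is needed.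
\<close>

lemma (in exp_law) mean_zero:
  assumes e: "e > 0" and exp: "\<And>t. \<bar>t - 1\<bar> < e \<Longrightarrow> integrable L (\<lambda>z. exp ((1 - t) * z)) \<and>
      expectation (\<lambda>z. exp ((1 - t) * z)) = exp (\<phi> t)"
    and deriv: "(\<phi> has_real_derivative 0) (at 1)"
  shows "expectation (\<lambda>z. z) = 0"
proof -
  let ?a = "expectation (\<lambda>z. z)"
  let ?\<psi> = "\<lambda>t. exp (\<phi> t) - 1 - (1 - t) * ?a"
  have phi_1: "exp (\<phi> 1) = 1"
    using exp[of 1] e by (simp add: prob_space)
  have "(?\<psi> has_real_derivative exp (\<phi> 1) * 0 - 0 - ((0 - 1) * ?a)) (at 1)"
    by (auto intro!: derivative_eq_intros deriv)
  then have d: "(?\<psi> has_real_derivative ?a) (at 1)"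
    by simp
  have "?\<psi> 1 \<le> ?\<psi> t" if "\<bar>1 - t\<bar> < e" for t
  proof -
    have t: "\<bar>t - 1\<bar> < e"
      using that by simp
    have "1 + (1 - t) * ?a = expectation (\<lambda>z. 1 + (1 - t) * z)"
      using integrable_id by (simp add: prob_space)
    also have "\<dots> \<le> expectation (\<lambda>z. exp ((1 - t) * z))"
      using integrable_id exp[OF t] by (intro integral_mono) auto
    finally show ?thesis
      using exp[OF t] phi_1 by simp
  qed
  then show ?thesis
    using DERIV_local_min[OF d e] by blast
qed

text \<open>This includes the case of no return, where the infimum of the empty set is
  infinity.\<close>

lemma less_first_return_nonneg_iff:
  "enat j < first_return_nonneg S \<omega> \<longleftrightarrow> (\<forall>k\<in>{1..j}. S k \<omega> < 0)"
proof
  assume less: "enat j < first_return_nonneg S \<omega>"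
  show "\<forall>k\<in>{1..j}. S k \<omega> < 0"
  proof (rule ccontr)
    assume "\<not> ?thesis"
    then obtain k where k: "k \<in> {1..j}" "S k \<omega> \<ge> 0"
      by (auto simp: not_less)
    then have "first_return_nonneg S \<omega> \<le> enat k"
      unfolding first_return_nonneg_def by (intro Inf_lower) auto
    also have "\<dots> \<le> enat j"
      using k by simp
    finally show False
      using less by simp
  qed
next
  assume neg: "\<forall>k\<in>{1..j}. S k \<omega> < 0"
  have "enat (Suc j) \<le> first_return_nonneg S \<omega>"
    unfolding first_return_nonneg_def
  proof (rule Inf_greatest)
    fix t
    assume "t \<in> {enat n | n. n \<ge> 1 \<and> S n \<omega> \<ge> 0}"
    then show "enat (Suc j) \<le> t"
      using neg by (force simp: not_less[symmetric] Suc_le_eq)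
  qed
  then show "enat j < first_return_nonneg S \<omega>"
    by (rule less_le_trans[rotated]) simp
qed

section \<open>Transfer to the given walk and branching random walk\<close>

lemma (in step_law) renewal_eq_renew:
  assumes aw: "associated_walk M \<xi> P S" and L: "L = distr P borel (S 1)"
  shows "renewal P S x = renew x"
proof -
  interpret P: prob_space P
    using aw by (simp add: associated_walk_def)
  let ?X = "\<lambda>\<omega> n. S (Suc n) \<omega> - S n \<omega>"
  have indep: "P.indep_vars (\<lambda>_. borel) (\<lambda>n \<omega>. ?X \<omega> n) UNIV"
    using aw by (simp add: associated_walk_def)
  have law: "distr P (\<Pi>\<^sub>M i\<in>UNIV. borel) ?X = paths"
    by (rule P.distr_iid_eq_PiM[OF indep]) (use aw L in \<open>simp add: associated_walk_def\<close>)
  have [measurable]: "?X \<in> P \<rightarrow>\<^sub>M (\<Pi>\<^sub>M i\<in>UNIV. borel)"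
    using indep by (intro measurable_PiM_single') (auto simp: P.indep_vars_def)
  have walk_eq: "walk j (?X \<omega>) = S j \<omega>" if "\<omega> \<in> space P" for j \<omega>
  proof -
    have "S 0 \<omega> = 0"
      using aw that by (simp add: associated_walk_def)
    then show ?thesis
      using sum_lessThan_telescope[of "\<lambda>i. S i \<omega>" j] by (simp add: walk_def)
  qed
  have "renewal P S x = (\<integral>\<^sup>+\<omega>. (\<Sum>j. indicator {- x..} (walk j (?X \<omega>)) * indicator {w. stays_neg j w} (?X \<omega>)) \<partial>P)"
    unfolding renewal_def
  proof (rule nn_integral_cong)
    fix \<omega>
    assume "\<omega> \<in> space P"
    then show "(\<integral>\<^sup>+j. indicator {j. S j \<omega> \<ge> - x} j \<partial>count_space {j. enat j < first_return_nonneg S \<omega>}) =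
        (\<Sum>j. indicator {- x..} (walk j (?X \<omega>)) * indicator {w. stays_neg j w} (?X \<omega>))"
      by (subst nn_integral_count_space_indicator)
        (auto simp: nn_integral_count_space_nat less_first_return_nonneg_iff stays_neg_def walk_eq
          intro!: suminf_cong split: split_indicator)
  qed
  also have "\<dots> = (\<Sum>j. \<integral>\<^sup>+\<omega>. indicator {- x..} (walk j (?X \<omega>)) * indicator {w. stays_neg j w} (?X \<omega>) \<partial>P)"
    by (rule nn_integral_suminf) measurable
  also have "\<dots> = renew x"
    unfolding renew_def green_def law[symmetric]
    by (intro suminf_cong nn_integral_distr[symmetric]) measurable
  finally show ?thesis .
qed

lemma position_coord: "position coord u (\<lambda>u. \<xi> u \<omega>) = position \<xi> u \<omega>"
  by (simp add: position_def coord_def)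

lemma survives_coord: "survives coord x u (\<lambda>u. \<xi> u \<omega>) = survives \<xi> x u \<omega>"
  by (simp add: survives_def min_position_def position_coord tree_def coord_def)

text \<open>Valid at every sample point: the finite sets \<open>words m n\<close> exhaust the labels
  of length n, and monotone convergence turns the sum over the generation into the supremum in
  \<open>tree_mart\<close>.\<close>

lemma (in branching_step) trunc_deriv_mart_eq:
  assumes renew: "\<And>x. renewal P S x = renew x"
  shows "trunc_deriv_mart \<xi> P S x n \<omega> = tree_mart x n (\<lambda>u. \<xi> u \<omega>)"
proof -
  let ?w = "\<lambda>u. \<xi> u \<omega>"
  let ?f = "\<lambda>u. ennreal (weight mart_weight x u ?w) * indicator {u. length u = n} u"
  have "trunc_deriv_mart \<xi> P S x n \<omega> = (\<integral>\<^sup>+u. ?f u \<partial>count_space UNIV)"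
    unfolding trunc_deriv_mart_def
  proof (subst nn_integral_count_space_indicator, simp, rule nn_integral_cong)
    fix u
    show "renewal P S (x + position \<xi> u \<omega>) * ennreal (exp (- (x + position \<xi> u \<omega>)))
        * indicator {u. 0 \<le> x + min_position \<xi> u \<omega>} u * indicator (generation \<xi> n \<omega>) u = ?f u"
    proof (cases "survives \<xi> x u \<omega>")
      case True
      have "renew (x + position \<xi> u \<omega>) = ennreal (renew_real (x + position \<xi> u \<omega>))"
        by (rule renew_eq_renew_real[OF survives_nonneg[OF True]])
      moreover have "weight mart_weight x u ?w = mart_weight (x + position \<xi> u \<omega>)"
        using True by (simp add: weight_def survives_coord position_coord)
      ultimately show ?thesis
        using True renew_real_ge_1[OF survives_nonneg[OF True]]
        by (auto simp: renew mart_weight_def ennreal_mult survives_def generation_def split: split_indicator)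
    next
      case False
      then have "weight mart_weight x u ?w = 0"
        by (simp add: weight_def survives_coord)
      then show ?thesis
        using False by (auto simp: survives_def generation_def split: split_indicator)
    qed
  qed
  also have "\<dots> = (\<integral>\<^sup>+u. (SUP m. ennreal (weight mart_weight x u ?w) * indicator (words m n) u) \<partial>count_space UNIV)"
  proof (rule nn_integral_cong)
    fix u
    have "(SUP m. indicator (words m n) u) = (indicator {u. length u = n} u :: ennreal)"
    proof (rule antisym)
      show "(SUP m. indicator (words m n) u) \<le> (indicator {u. length u = n} u :: ennreal)"
        by (intro SUP_least) (auto simp: words_def split: split_indicator)
      \<comment> \<open>For the empty label the maximum is unspecified, but then there is no entry
        to bound.\<close>
      have "u \<in> words (Suc (Max (set u))) n" if "length u = n"
        using that by (auto simp: words_def less_Suc_eq_le)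
      then have "(indicator {u. length u = n} u :: ennreal) \<le> indicator (words (Suc (Max (set u))) n) u"
        by (auto split: split_indicator)
      also have "\<dots> \<le> (SUP m. indicator (words m n) u)"
        by (rule SUP_upper) simp
      finally show "(indicator {u. length u = n} u :: ennreal) \<le> (SUP m. indicator (words m n) u)" .
    qed
    then show "?f u = (SUP m. ennreal (weight mart_weight x u ?w) * indicator (words m n) u)"
      by (simp add: SUP_mult_left_ennreal[symmetric])
  qed
  also have "\<dots> = (SUP m. \<integral>\<^sup>+u. ennreal (weight mart_weight x u ?w) * indicator (words m n) u \<partial>count_space UNIV)"
    by (rule nn_integral_monotone_convergence_SUP)
      (auto intro!: monoI le_funI mult_left_mono split: split_indicator dest: subsetD[OF words_mono])
  also have "\<dots> = tree_mart x n ?w"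
    unfolding tree_mart_def finite_mart_def
    by (intro SUP_cong refl)
      (simp add: nn_integral_count_space_indicator[symmetric] nn_integral_count_space_finite weight_mart_weight_nonneg)
  finally show ?thesis .
qed

theorem theorem1p2:
  fixes M :: "'w measure" and \<xi> :: "'w displacements"
    and P :: "'b measure" and S :: "nat \<Rightarrow> 'b \<Rightarrow> real"
  assumes "branching_random_walk M \<xi>"
    and "associated_walk M \<xi> P S"
    and "log_laplace M \<xi> 0 > 0"
    and "log_laplace M \<xi> 1 = 0"
    and "\<exists>\<epsilon>>0. \<forall>\<theta>. \<bar>\<theta> - 1\<bar> < \<epsilon> \<longrightarrow> \<bar>log_laplace M \<xi> \<theta>\<bar> \<noteq> \<infinity>"
    and "((\<lambda>\<theta>. real_of_ereal (log_laplace M \<xi> \<theta>)) has_real_derivative 0) (at 1)"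
    and "\<exists>\<delta>>0. (\<integral>\<^sup>+\<omega>. exp_ennreal (ennreal \<delta> * first_generation_sum \<xi> \<omega>) \<partial>M) < \<infinity>"
  shows "\<exists>C>0. \<exists>c>0. \<forall>x>0. \<forall>y\<ge>1. \<forall>n :: enat.
    emeasure M {\<omega> \<in> space M. trunc_deriv_mart_ext \<xi> P S x n \<omega> > ennreal y}
      \<le> ennreal C * renewal P S x * ennreal (exp (- x) * exp (- c * y))"
proof -
  note brw = assms(1) and aw = assms(2)
  interpret M: prob_space M
    using brw by (simp add: branching_random_walk_def)
  interpret P: prob_space P
    using aw by (simp add: associated_walk_def)
  let ?B = "\<Pi>\<^sub>M i\<in>(UNIV :: nat set). (borel :: ereal measure)"
  have indep: "M.indep_vars (\<lambda>_. ?B) \<xi> UNIV" and law: "distr M ?B (\<xi> u) = distr M ?B (\<xi> [])" for u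
    using brw by (auto simp: branching_random_walk_def)
  have \<xi> [measurable]: "\<xi> u \<in> M \<rightarrow>\<^sub>M ?B" for u
    using indep by (auto simp: M.indep_vars_def)
  define N where "N = distr M ?B (\<xi> [])"
  define L where "L = distr P borel (S 1)"
  have S1 [measurable]: "S 1 \<in> borel_measurable P"
    by (rule many_to_one_of_associated_walk[OF brw aw assms(4), of "\<lambda>_. 0"]) simp
  have many_to_one: "(\<integral>\<^sup>+\<omega>. point_sum (\<lambda>v. f v * ennreal (exp (- v))) (\<xi> [] \<omega>) \<partial>M) = (\<integral>\<^sup>+z. f z \<partial>L)"
    if "f \<in> borel_measurable borel" for f
    unfolding L_def by (rule many_to_one_of_associated_walk[OF brw aw assms(4) that])
  interpret L: prob_space L
    unfolding L_def by (rule P.prob_space_distr) measurable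
  have sets_L [measurable_cong]: "sets L = sets borel"
    by (simp add: L_def)
  \<comment> \<open>After the change of measure the transform at t is the logarithm of E exp((1 - t)
    z). Finiteness near 1 becomes exponential moments of the step, and the value at 0 becomes ln E
    exp(z).\<close>
  have laplace: "log_laplace M \<xi> t = ln_ennreal (\<integral>\<^sup>+z. ennreal (exp ((1 - t) * z)) \<partial>L)" for t
  proof -
    have "(\<integral>\<^sup>+z. ennreal (exp ((1 - t) * z)) \<partial>L) = (\<integral>\<^sup>+\<omega>. point_sum (\<lambda>v. ennreal (exp (- t * v))) (\<xi> [] \<omega>) \<partial>M)"
      by (subst many_to_one[symmetric]) (simp_all add: ennreal_mult[symmetric] mult_exp_exp algebra_simps)
    then show ?thesis
      by (simp only: log_laplace_eq)
  qed
  obtain e where e: "e > 0" and fin: "\<And>t. \<bar>t - 1\<bar> < e \<Longrightarrow> \<bar>log_laplace M \<xi> t\<bar> \<noteq> \<infinity>"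
    using assms(5) by blast
  have exp_L: "integrable L (\<lambda>z. exp ((1 - t) * z)) \<and>
      L.expectation (\<lambda>z. exp ((1 - t) * z)) = exp (real_of_ereal (log_laplace M \<xi> t))" if "\<bar>t - 1\<bar> < e" for t
  proof -
    have *: "(\<integral>\<^sup>+z. ennreal (exp ((1 - t) * z)) \<partial>L) = ennreal (exp (real_of_ereal (log_laplace M \<xi> t)))"
      unfolding laplace by (rule ln_ennreal_finite) (use fin[OF that] in \<open>simp add: laplace\<close>)
    then have "has_bochner_integral L (\<lambda>z. exp ((1 - t) * z)) (exp (real_of_ereal (log_laplace M \<xi> t)))"
      by (intro has_bochner_integral_nn_integral) auto
    then show ?thesis
      by (simp add: has_bochner_integral_iff)
  qed
  \<comment> \<open>A third of e leaves room for both exponents 2 l and - 2 l, that is, for t = 1 -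
    2 l and t = 1 + 2 l.\<close>
  define l where "l = min (1 / 2) (e / 3)"
  have l: "0 < l" "l \<le> 1 / 2" "2 * l < e"
    using e by (auto simp: l_def)
  interpret exp_law L l
    by unfold_locales (use l sets_L exp_L[of "1 - 2 * l"] exp_L[of "1 + 2 * l"] in auto)
  have mean: "L.expectation (\<lambda>z. z) = 0"
    by (rule mean_zero[OF e exp_L assms(6)])
  \<comment> \<open>A step that is 0 almost surely would give E exp(z) = 1, hence a transform
    vanishing at 0. This is where supercriticality enters.\<close>
  have nondeg: "\<not> (AE z in L. z = 0)"
  proof
    assume "AE z in L. z = 0"
    then have "(\<integral>\<^sup>+z. ennreal (exp ((1 - 0) * z)) \<partial>L) = (\<integral>\<^sup>+z. 1 \<partial>L)"
      by (intro nn_integral_cong_AE) auto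
    then show False
      using assms(3) unfolding laplace by (simp add: L.emeasure_space_1 ln_ennreal_def)
  qed
  obtain d where d: "d > 0" and moment: "(\<integral>\<^sup>+\<omega>. exp_ennreal (ennreal d * first_generation_sum \<xi> \<omega>) \<partial>M) < \<infinity>"
    using assms(7) by blast
  interpret branching_step L l N d
  proof (intro branching_step.intro branching_step_axioms.intro step_law.intro step_law_axioms.intro)
    show "exp_law L l"
      by unfold_locales
    show "(\<integral>z. z \<partial>L) = 0" "\<not> (AE z in L. z = 0)" "0 < d"
      using mean nondeg d by auto
    show "prob_space N"
      unfolding N_def by (intro M.prob_space_distr) measurable
    show "sets N = sets ?B"
      by (simp add: N_def)
    fix f :: "real \<Rightarrow> ennreal"
    assume [measurable]: "f \<in> borel_measurable borel"
    show "(\<integral>\<^sup>+y. point_sum (\<lambda>v. f v * ennreal (exp (- v))) y \<partial>N) = (\<integral>\<^sup>+z. f z \<partial>L)"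
      unfolding N_def by (subst nn_integral_distr) (simp_all add: many_to_one)
  next
    have [measurable]: "exp_ennreal \<in> borel_measurable borel"
      unfolding exp_ennreal_def[abs_def] by measurable
    show "(\<integral>\<^sup>+y. exp_ennreal (ennreal d * point_sum (\<lambda>v. ennreal ((1 + max v 0) * exp (- v))) y) \<partial>N) < \<infinity>"
      using moment unfolding N_def first_generation_sum_eq
      by (subst nn_integral_distr) simp_all
  qed
  let ?\<Xi> = "\<lambda>\<omega> u. \<xi> u \<omega>"
  have trees_law: "distr M labels ?\<Xi> = trees"
    unfolding N_def by (rule M.distr_iid_eq_PiM[OF indep law])
  have \<Xi> [measurable]: "?\<Xi> \<in> M \<rightarrow>\<^sub>M labels"
    by (rule measurable_PiM_single') (auto intro: \<xi> simp: space_PiM)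
  have space_trees: "space trees = UNIV"
    using sets_eq_imp_space_eq[OF sets_trees] by (simp add: space_PiM)
  \<comment> \<open>The superset \<open>E\<close> lets one statement serve every n, including n =
    infinity, where the event involves \<open>lim\<close>.\<close>
  have transfer: "emeasure M {\<omega> \<in> space M. Q (?\<Xi> \<omega>)} \<le> emeasure trees E"
    if "E \<in> sets trees" "{w \<in> space trees. Q w} \<subseteq> E" for E Q
  proof -
    have E: "E \<in> sets labels"
      using that sets_trees by simp
    have "emeasure M {\<omega> \<in> space M. Q (?\<Xi> \<omega>)} \<le> emeasure M (?\<Xi> -` E \<inter> space M)"
      using that(2) by (intro emeasure_mono measurable_sets[OF \<Xi> E]) (auto simp: space_trees)
    also have "\<dots> = emeasure trees E"
      unfolding trees_law[symmetric] by (rule emeasure_distr[OF \<Xi> E, symmetric])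
    finally show ?thesis .
  qed
  have renew: "renewal P S x = renew x" for x
    by (rule renewal_eq_renew[OF aw L_def])
  note finite_mart_eq = trunc_deriv_mart_eq[of P S, OF renew]
  obtain C c where Cc: "C > 0" "c > 0" and tail: "\<forall>x\<ge>0. \<forall>y\<ge>1. \<forall>m n.
      emeasure trees {w \<in> space trees. y < finite_mart x m n w} \<le> ennreal (C * mart_weight x * exp (- c * y))"
    using finite_mart_tail by (elim exE conjE) (rule that)
  have "emeasure M {\<omega> \<in> space M. trunc_deriv_mart_ext \<xi> P S x n \<omega> > ennreal y}
      \<le> ennreal C * renewal P S x * ennreal (exp (- x) * exp (- c * y))"
    if x: "x > 0" and y: "y \<ge> 1" for x y :: real and n :: enat
  proof -
    let ?b = "ennreal (C * mart_weight x * exp (- c * y))"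
    have fin_tail: "emeasure trees {w \<in> space trees. ennreal y < tree_mart x k w} \<le> ?b" for k
      by (intro tree_mart_tail tail[rule_format]) (use x y in auto)
    have "emeasure M {\<omega> \<in> space M. trunc_deriv_mart_ext \<xi> P S x n \<omega> > ennreal y} \<le> ?b"
    proof (cases n)
      case (enat k)
      have "emeasure M {\<omega> \<in> space M. ennreal y < tree_mart x k (?\<Xi> \<omega>)}
          \<le> emeasure trees {w \<in> space trees. ennreal y < tree_mart x k w}"
        by (rule transfer) auto
      then show ?thesis
        using fin_tail[of k] by (simp add: enat trunc_deriv_mart_ext_def finite_mart_eq)
    next
      case infinity
      obtain E where E: "E \<in> sets trees" "{w \<in> space trees. ennreal y < lim (\<lambda>k. tree_mart x k w)} \<subseteq> E"
        "emeasure trees E \<le> ?b"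
        using tree_mart_lim_tail[OF fin_tail] by blast
      show ?thesis
        using order_trans[OF transfer[OF E(1,2)] E(3)]
        by (simp add: infinity trunc_deriv_mart_ext_def finite_mart_eq)
    qed
    also have "?b = ennreal C * renewal P S x * ennreal (exp (- x) * exp (- c * y))"
      using Cc x renew_real_ge_1[of x] by (simp add: renew renew_eq_renew_real mart_weight_def ennreal_mult[symmetric] mult.assoc)
    finally show ?thesis .
  qed
  then show ?thesis
    using Cc by blast
qed

end
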